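(* Let $\mathcal{A}$ be a locally noetherian Grothendieck category and let $\gamma$ be a left exact preradical functor on $\mathcal{A}$. Then $\gamma$ is a subfunctor of $\Gamma_{U_\gamma}$. Moreover, if $\gamma$ is radical, then $\gamma=\Gamma_{U_\gamma}$.
   Context: A nonzero object $H$ of $\mathcal{A}$ is monoform if for every nonzero subobject $N$ of $H$, no nonzero subobject of $H$ is isomorphic to a subobject of $H/N$. Two monoform objects are atom-equivalent if they have isomorphic nonzero subobjects (this is an equivalence relation); the class of $H$ is denoted $\overline{H}$ and called an atom; $\mathrm{ASpec}\,\mathcal{A}$ is the set of atoms. For an object $M$, $\mathrm{ASupp}(M)$ is the set of atoms $\alpha$ such that some $H\in\alpha$ is a subquotient of $M$. A subset $\Phi\subseteq\mathrm{ASpec}\,\mathcal{A}$ is open if for every $\alpha\in\Phi$ there is $H\in\alpha$ with $\mathrm{ASupp}(H)\subseteq\Phi$. For an open subset $U$ of $\mathrm{ASpec}\,\mathcal{A}$, the section functor $\Gamma_U$ assigns to $M$ the largest subobject $\Gamma_U(M)$ of $M$ with $\mathrm{ASupp}(\Gamma_U(M))\subseteq U$. A preradical functor on $\mathcal{A}$ is a subobject $\gamma$ of the identity functor; it is radical if $\gamma(M/\gamma(M))=0$ for every $M$. Put $\mathcal{T}_\gamma=\{T\in\mathcal{A}\mid\gamma(T)=T\}$ and $U_\gamma=\{\alpha\in\mathrm{ASpec}\,\mathcal{A}\mid H\in\mathcal{T}_\gamma\text{ for some monoform object }H\in\alpha\}$. For a left exact preradical $\gamma$, $U_\gamma$ is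 an open subset of $\mathrm{ASpec}\,\mathcal{A}$. *)

theory Defs
  imports "HOL-Algebra.Group"
begin

section \<open>Small sets\<close>

text \<open>
  Size conventions are relative to a universe, represented by its cardinal \<open>\<kappa>\<close>; a set of any type
  is small if its cardinality is below \<open>\<kappa>\<close>.  The objects and the arrows of a category need not form
  small sets.  The universe cardinals are the strongly inaccessible cardinals together with
  \<open>\<aleph>\<^sub>0\<close> (the universe of hereditarily finite sets, which is admitted because nothing below depends
  on excluding it).  Every small set is equipollent to a subset of the carrier type \<open>'k\<close> of \<open>\<kappa>\<close>,
  so it is enough to use index sets of type \<open>'k set\<close>.
\<close>

unbundle cardinal_syntax

definition small :: "'k rel \<Rightarrow> 'b set \<Rightarrow> bool" where
  "small \<kappa> A \<longleftrightarrow> |A| <o \<kappa>"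

definition universe_cardinal :: "'k rel \<Rightarrow> bool" where
  "universe_cardinal \<kappa> \<longleftrightarrow>
     Cinfinite \<kappa> \<and> regularCard \<kappa> \<and> (\<forall>A :: 'k set. small \<kappa> A \<longrightarrow> small \<kappa> (Pow A))"

section \<open>Categories\<close>

record ('o, 'a) cat =
  Obj :: "'o set"
  Arr :: "'a set"
  Dom :: "'a \<Rightarrow> 'o"
  Cod :: "'a \<Rightarrow> 'o"
  Idn :: "'o \<Rightarrow> 'a"
  Comp :: "'a \<Rightarrow> 'a \<Rightarrow> 'a" (infixl \<open>\<cdot>\<index>\<close> 70)

definition Hom :: "('o, 'a, 'm) cat_scheme \<Rightarrow> 'o \<Rightarrow> 'o \<Rightarrow> 'a set" where
  "Hom C X Y = {f \<in> Arr C. Dom C f = X \<and> Cod C f = Y}"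

locale cat =
  fixes C :: "('o, 'a, 'm) cat_scheme" (structure)
  assumes Dom_Obj: "f \<in> Arr C \<Longrightarrow> Dom C f \<in> Obj C"
    and Cod_Obj: "f \<in> Arr C \<Longrightarrow> Cod C f \<in> Obj C"
    and Idn_Hom: "X \<in> Obj C \<Longrightarrow> Idn C X \<in> Hom C X X"
    and Comp_Hom: "\<lbrakk>g \<in> Hom C Y Z; f \<in> Hom C X Y\<rbrakk> \<Longrightarrow> g \<cdot> f \<in> Hom C X Z"
    and Comp_Idn: "f \<in> Hom C X Y \<Longrightarrow> f \<cdot> Idn C X = f"
    and Idn_Comp: "f \<in> Hom C X Y \<Longrightarrow> Idn C Y \<cdot> f = f"
    and Comp_assoc:
      "\<lbrakk>h \<in> Hom C Y Z; g \<in> Hom C X Y; f \<in> Hom C W X\<rbrakk> \<Longrightarrow> (h \<cdot> g) \<cdot> f = h \<cdot> (g \<cdot> f)"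

definition monic :: "('o, 'a, 'm) cat_scheme \<Rightarrow> 'a \<Rightarrow> bool" where
  "monic C m \<longleftrightarrow> m \<in> Arr C \<and>
     (\<forall>X. \<forall>f \<in> Hom C X (Dom C m). \<forall>g \<in> Hom C X (Dom C m). m \<cdot>\<^bsub>C\<^esub> f = m \<cdot>\<^bsub>C\<^esub> g \<longrightarrow> f = g)"

definition epic :: "('o, 'a, 'm) cat_scheme \<Rightarrow> 'a \<Rightarrow> bool" where
  "epic C e \<longleftrightarrow> e \<in> Arr C \<and>
     (\<forall>Y. \<forall>f \<in> Hom C (Cod C e) Y. \<forall>g \<in> Hom C (Cod C e) Y. f \<cdot>\<^bsub>C\<^esub> e = g \<cdot>\<^bsub>C\<^esub> e \<longrightarrow> f = g)"

definition iso_arr :: "('o, 'a, 'm) cat_scheme \<Rightarrow> 'a \<Rightarrow> bool" where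
  "iso_arr C f \<longleftrightarrow> f \<in> Arr C \<and>
     (\<exists>g \<in> Hom C (Cod C f) (Dom C f). g \<cdot>\<^bsub>C\<^esub> f = Idn C (Dom C f) \<and> f \<cdot>\<^bsub>C\<^esub> g = Idn C (Cod C f))"

definition isomorphic :: "('o, 'a, 'm) cat_scheme \<Rightarrow> 'o \<Rightarrow> 'o \<Rightarrow> bool" where
  "isomorphic C X Y \<longleftrightarrow> (\<exists>f \<in> Hom C X Y. iso_arr C f)"

definition zero_obj :: "('o, 'a, 'm) cat_scheme \<Rightarrow> 'o \<Rightarrow> bool" where
  "zero_obj C Z \<longleftrightarrow> Z \<in> Obj C \<and> (\<forall>X \<in> Obj C. (\<exists>!f. f \<in> Hom C X Z) \<and> (\<exists>!f. f \<in> Hom C Z X))"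

definition nonzero_obj :: "('o, 'a, 'm) cat_scheme \<Rightarrow> 'o \<Rightarrow> bool" where
  "nonzero_obj C X \<longleftrightarrow> X \<in> Obj C \<and> \<not> zero_obj C X"

definition is_coproduct ::
  "('o, 'a, 'm) cat_scheme \<Rightarrow> 'i set \<Rightarrow> ('i \<Rightarrow> 'o) \<Rightarrow> 'o \<Rightarrow> ('i \<Rightarrow> 'a) \<Rightarrow> bool" where
  "is_coproduct C I X S c \<longleftrightarrow> S \<in> Obj C \<and> (\<forall>i \<in> I. c i \<in> Hom C (X i) S) \<and>
     (\<forall>Y \<in> Obj C. \<forall>f. (\<forall>i \<in> I. f i \<in> Hom C (X i) Y) \<longrightarrow>
        (\<exists>!u. u \<in> Hom C S Y \<and> (\<forall>i \<in> I. u \<cdot>\<^bsub>C\<^esub> c i = f i)))"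

section \<open>Subobjects\<close>

text \<open>
  A subobject of \<open>M\<close> is represented by a monomorphism into \<open>M\<close>; two of them represent the same
  subobject iff they are \<open>sub_le\<close> in both directions.
\<close>

definition subobj :: "('o, 'a, 'm) cat_scheme \<Rightarrow> 'o \<Rightarrow> 'a \<Rightarrow> bool" where
  "subobj C M m \<longleftrightarrow> monic C m \<and> Cod C m = M"

definition sub_le :: "('o, 'a, 'm) cat_scheme \<Rightarrow> 'a \<Rightarrow> 'a \<Rightarrow> bool" where
  "sub_le C m n \<longleftrightarrow> (\<exists>u \<in> Hom C (Dom C m) (Dom C n). n \<cdot>\<^bsub>C\<^esub> u = m)"

definition subquotient :: "('o, 'a, 'm) cat_scheme \<Rightarrow> 'o \<Rightarrow> 'o \<Rightarrow> bool" where
  "subquotient C H M \<longleftrightarrow> (\<exists>n e. subobj C M n \<and> epic C e \<and> Dom C e = Dom C n \<and> Cod C e = H)"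

definition noetherian_obj :: "('o, 'a, 'm) cat_scheme \<Rightarrow> 'o \<Rightarrow> bool" where
  "noetherian_obj C M \<longleftrightarrow> M \<in> Obj C \<and>
     (\<forall>m :: nat \<Rightarrow> 'a. (\<forall>n. subobj C M (m n) \<and> sub_le C (m n) (m (Suc n))) \<longrightarrow>
        (\<exists>N. \<forall>n \<ge> N. sub_le C (m n) (m N)))"

section \<open>Functors and natural transformations\<close>

record ('o, 'a, 'p, 'b) cfunctor =
  Fobj :: "'o \<Rightarrow> 'p"
  Farr :: "'a \<Rightarrow> 'b"

definition is_functor ::
  "('o, 'a, 'm) cat_scheme \<Rightarrow> ('p, 'b, 'n) cat_scheme \<Rightarrow>
   ('o, 'a, 'p, 'b, 'f) cfunctor_scheme \<Rightarrow> bool" where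
  "is_functor C D F \<longleftrightarrow> cat C \<and> cat D \<and>
     (\<forall>X \<in> Obj C. Fobj F X \<in> Obj D \<and> Farr F (Idn C X) = Idn D (Fobj F X)) \<and>
     (\<forall>X Y. \<forall>f \<in> Hom C X Y. Farr F f \<in> Hom D (Fobj F X) (Fobj F Y)) \<and>
     (\<forall>X Y Z. \<forall>g \<in> Hom C Y Z. \<forall>f \<in> Hom C X Y. Farr F (g \<cdot>\<^bsub>C\<^esub> f) = Farr F g \<cdot>\<^bsub>D\<^esub> Farr F f)"

definition id_functor :: "('o, 'a, 'o, 'a) cfunctor" where
  "id_functor = \<lparr>Fobj = (\<lambda>X. X), Farr = (\<lambda>f. f)\<rparr>"

definition nat_trans ::
  "('o, 'a, 'm) cat_scheme \<Rightarrow> ('p, 'b, 'n) cat_scheme \<Rightarrow>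
   ('o, 'a, 'p, 'b, 'f) cfunctor_scheme \<Rightarrow> ('o, 'a, 'p, 'b, 'g) cfunctor_scheme \<Rightarrow>
   ('o \<Rightarrow> 'b) \<Rightarrow> bool" where
  "nat_trans C D F G \<tau> \<longleftrightarrow>
     (\<forall>X \<in> Obj C. \<tau> X \<in> Hom D (Fobj F X) (Fobj G X)) \<and>
     (\<forall>X Y. \<forall>f \<in> Hom C X Y. \<tau> Y \<cdot>\<^bsub>D\<^esub> Farr F f = Farr G f \<cdot>\<^bsub>D\<^esub> \<tau> X)"

section \<open>Abelian categories\<close>

record ('o, 'a) ab_cat = "('o, 'a) cat" +
  Zer :: "'o \<Rightarrow> 'o \<Rightarrow> 'a"
  Add :: "'a \<Rightarrow> 'a \<Rightarrow> 'a" (infixl \<open>\<boxplus>\<index>\<close> 65)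

definition Hom_group :: "('o, 'a, 'm) ab_cat_scheme \<Rightarrow> 'o \<Rightarrow> 'o \<Rightarrow> 'a monoid" where
  "Hom_group C X Y = \<lparr>carrier = Hom C X Y, mult = Add C, one = Zer C X Y\<rparr>"

definition is_kernel :: "('o, 'a, 'm) ab_cat_scheme \<Rightarrow> 'a \<Rightarrow> 'a \<Rightarrow> bool" where
  "is_kernel C f k \<longleftrightarrow> f \<in> Arr C \<and> k \<in> Arr C \<and> Cod C k = Dom C f \<and>
     f \<cdot>\<^bsub>C\<^esub> k = Zer C (Dom C k) (Cod C f) \<and>
     (\<forall>X. \<forall>h \<in> Hom C X (Dom C f). f \<cdot>\<^bsub>C\<^esub> h = Zer C X (Cod C f) \<longrightarrow>
        (\<exists>!u. u \<in> Hom C X (Dom C k) \<and> k \<cdot>\<^bsub>C\<^esub> u = h))"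

definition is_cokernel :: "('o, 'a, 'm) ab_cat_scheme \<Rightarrow> 'a \<Rightarrow> 'a \<Rightarrow> bool" where
  "is_cokernel C f q \<longleftrightarrow> f \<in> Arr C \<and> q \<in> Arr C \<and> Dom C q = Cod C f \<and>
     q \<cdot>\<^bsub>C\<^esub> f = Zer C (Dom C f) (Cod C q) \<and>
     (\<forall>Y. \<forall>h \<in> Hom C (Cod C f) Y. h \<cdot>\<^bsub>C\<^esub> f = Zer C (Dom C f) Y \<longrightarrow>
        (\<exists>!u. u \<in> Hom C (Cod C q) Y \<and> u \<cdot>\<^bsub>C\<^esub> q = h))"

definition short_exact :: "('o, 'a, 'm) ab_cat_scheme \<Rightarrow> 'a \<Rightarrow> 'a \<Rightarrow> bool" where
  "short_exact C f g \<longleftrightarrow> is_kernel C g f \<and> is_cokernel C f g"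

locale preadditive_cat = cat C
  for C :: "('o, 'a, 'm) ab_cat_scheme" (structure) +
  assumes Hom_comm_group: "\<lbrakk>X \<in> Obj C; Y \<in> Obj C\<rbrakk> \<Longrightarrow> comm_group (Hom_group C X Y)"
    and Comp_Add:
      "\<lbrakk>h \<in> Hom C Y Z; f \<in> Hom C X Y; g \<in> Hom C X Y\<rbrakk> \<Longrightarrow> h \<cdot> (f \<boxplus> g) = (h \<cdot> f) \<boxplus> (h \<cdot> g)"
    and Add_Comp:
      "\<lbrakk>f \<in> Hom C Y Z; g \<in> Hom C Y Z; h \<in> Hom C X Y\<rbrakk> \<Longrightarrow> (f \<boxplus> g) \<cdot> h = (f \<cdot> h) \<boxplus> (g \<cdot> h)"

locale abelian_cat = preadditive_cat C
  for C :: "('o, 'a, 'm) ab_cat_scheme" (structure) +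
  assumes ex_zero_obj: "\<exists>Z. zero_obj C Z"
    and ex_biproduct: "\<lbrakk>X \<in> Obj C; Y \<in> Obj C\<rbrakk> \<Longrightarrow>
      \<exists>S. \<exists>i \<in> Hom C X S. \<exists>j \<in> Hom C Y S. \<exists>p \<in> Hom C S X. \<exists>q \<in> Hom C S Y.
        p \<cdot> i = Idn C X \<and> q \<cdot> j = Idn C Y \<and> p \<cdot> j = Zer C Y X \<and> q \<cdot> i = Zer C X Y \<and>
        (i \<cdot> p) \<boxplus> (j \<cdot> q) = Idn C S"
    and ex_kernel: "f \<in> Arr C \<Longrightarrow> \<exists>k. is_kernel C f k"
    and ex_cokernel: "f \<in> Arr C \<Longrightarrow> \<exists>q. is_cokernel C f q"
    and monic_normal: "monic C m \<Longrightarrow> \<exists>f. is_kernel C f m"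
    and epic_normal: "epic C e \<Longrightarrow> \<exists>f. is_cokernel C f e"

definition left_exact ::
  "('o, 'a, 'm) ab_cat_scheme \<Rightarrow> ('p, 'b, 'n) ab_cat_scheme \<Rightarrow>
   ('o, 'a, 'p, 'b, 'f) cfunctor_scheme \<Rightarrow> bool" where
  "left_exact C D F \<longleftrightarrow> (\<forall>f g. is_kernel C g f \<longrightarrow> is_kernel D (Farr F g) (Farr F f))"

section \<open>Direct limits and Grothendieck categories\<close>

definition directed :: "'i set \<Rightarrow> 'i rel \<Rightarrow> bool" where
  "directed I r \<longleftrightarrow> I \<noteq> {} \<and> preorder_on I r \<and> (\<forall>i \<in> I. \<forall>j \<in> I. \<exists>k \<in> I. (i, k) \<in> r \<and> (j, k) \<in> r)"

definition direct_system ::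
  "('o, 'a, 'm) cat_scheme \<Rightarrow> 'i set \<Rightarrow> 'i rel \<Rightarrow> ('i \<Rightarrow> 'o) \<Rightarrow> ('i \<Rightarrow> 'i \<Rightarrow> 'a) \<Rightarrow> bool" where
  "direct_system C I r X t \<longleftrightarrow> directed I r \<and>
     (\<forall>i \<in> I. X i \<in> Obj C \<and> t i i = Idn C (X i)) \<and>
     (\<forall>i j. (i, j) \<in> r \<longrightarrow> t i j \<in> Hom C (X i) (X j)) \<and>
     (\<forall>i j k. (i, j) \<in> r \<and> (j, k) \<in> r \<longrightarrow> t j k \<cdot>\<^bsub>C\<^esub> t i j = t i k)"

definition system_hom ::
  "('o, 'a, 'm) cat_scheme \<Rightarrow> 'i set \<Rightarrow> 'i rel \<Rightarrow> ('i \<Rightarrow> 'o) \<Rightarrow> ('i \<Rightarrow> 'i \<Rightarrow> 'a) \<Rightarrow>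
   ('i \<Rightarrow> 'o) \<Rightarrow> ('i \<Rightarrow> 'i \<Rightarrow> 'a) \<Rightarrow> ('i \<Rightarrow> 'a) \<Rightarrow> bool" where
  "system_hom C I r X t Y s f \<longleftrightarrow>
     (\<forall>i \<in> I. f i \<in> Hom C (X i) (Y i)) \<and>
     (\<forall>i j. (i, j) \<in> r \<longrightarrow> f j \<cdot>\<^bsub>C\<^esub> t i j = s i j \<cdot>\<^bsub>C\<^esub> f i)"

definition cocone ::
  "('o, 'a, 'm) cat_scheme \<Rightarrow> 'i set \<Rightarrow> 'i rel \<Rightarrow> ('i \<Rightarrow> 'o) \<Rightarrow> ('i \<Rightarrow> 'i \<Rightarrow> 'a) \<Rightarrow>
   'o \<Rightarrow> ('i \<Rightarrow> 'a) \<Rightarrow> bool" where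
  "cocone C I r X t L c \<longleftrightarrow> L \<in> Obj C \<and> (\<forall>i \<in> I. c i \<in> Hom C (X i) L) \<and>
     (\<forall>i j. (i, j) \<in> r \<longrightarrow> c j \<cdot>\<^bsub>C\<^esub> t i j = c i)"

definition is_direct_limit ::
  "('o, 'a, 'm) cat_scheme \<Rightarrow> 'i set \<Rightarrow> 'i rel \<Rightarrow> ('i \<Rightarrow> 'o) \<Rightarrow> ('i \<Rightarrow> 'i \<Rightarrow> 'a) \<Rightarrow>
   'o \<Rightarrow> ('i \<Rightarrow> 'a) \<Rightarrow> bool" where
  "is_direct_limit C I r X t L c \<longleftrightarrow> cocone C I r X t L c \<and>
     (\<forall>M d. cocone C I r X t M d \<longrightarrow> (\<exists>!u. u \<in> Hom C L M \<and> (\<forall>i \<in> I. u \<cdot>\<^bsub>C\<^esub> c i = d i)))"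

definition is_generator :: "('o, 'a, 'm) cat_scheme \<Rightarrow> 'o set \<Rightarrow> bool" where
  "is_generator C \<G> \<longleftrightarrow> \<G> \<subseteq> Obj C \<and>
     (\<forall>X Y. \<forall>f \<in> Hom C X Y. \<forall>g \<in> Hom C X Y.
        (\<forall>G \<in> \<G>. \<forall>h \<in> Hom C G X. f \<cdot>\<^bsub>C\<^esub> h = g \<cdot>\<^bsub>C\<^esub> h) \<longrightarrow> f = g)"

locale grothendieck_cat = abelian_cat C
  for \<kappa> :: "'k rel" and C :: "('o, 'a, 'm) ab_cat_scheme" (structure) +
  assumes universe: "universe_cardinal \<kappa>"
    and locally_small: "\<lbrakk>X \<in> Obj C; Y \<in> Obj C\<rbrakk> \<Longrightarrow> small \<kappa> (Hom C X Y)"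
    and ex_coproduct: "\<And>(I :: 'k set) X. \<lbrakk>small \<kappa> I; \<And>i. i \<in> I \<Longrightarrow> X i \<in> Obj C\<rbrakk> \<Longrightarrow>
      \<exists>S c. is_coproduct C I X S c"
    and ex_direct_limit: "\<And>(I :: 'k set) r X t. \<lbrakk>small \<kappa> I; direct_system C I r X t\<rbrakk> \<Longrightarrow>
      \<exists>L c. is_direct_limit C I r X t L c"
    and direct_limit_exact: "\<And>(I :: 'k set) r X t Y s Z w f g A a B b D d u v.
      \<lbrakk>small \<kappa> I;
       direct_system C I r X t; direct_system C I r Y s; direct_system C I r Z w;
       system_hom C I r X t Y s f; system_hom C I r Y s Z w g;
       \<And>i. i \<in> I \<Longrightarrow> short_exact C (f i) (g i);
       is_direct_limit C I r X t A a; is_direct_limit C I r Y s B b; is_direct_limit C I r Z w D d;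
       u \<in> Hom C A B; \<And>i. i \<in> I \<Longrightarrow> u \<cdot> a i = b i \<cdot> f i;
       v \<in> Hom C B D; \<And>i. i \<in> I \<Longrightarrow> v \<cdot> b i = d i \<cdot> g i\<rbrakk> \<Longrightarrow> short_exact C u v"
    and ex_generator: "\<exists>G. is_generator C {G}"

locale locally_noetherian_cat = grothendieck_cat \<kappa> C
  for \<kappa> :: "'k rel" and C :: "('o, 'a, 'm) ab_cat_scheme" (structure) +
  assumes ex_noetherian_generators:
    "\<exists>\<G>. small \<kappa> \<G> \<and> is_generator C \<G> \<and> (\<forall>G \<in> \<G>. noetherian_obj C G)"

section \<open>Atoms\<close>

definition monoform :: "('o, 'a, 'm) ab_cat_scheme \<Rightarrow> 'o \<Rightarrow> bool" where
  "monoform C H \<longleftrightarrow> nonzero_obj C H \<and>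
     (\<forall>n q. subobj C H n \<and> nonzero_obj C (Dom C n) \<and> is_cokernel C n q \<longrightarrow>
        \<not> (\<exists>a b. subobj C H a \<and> nonzero_obj C (Dom C a) \<and> subobj C (Cod C q) b \<and>
             isomorphic C (Dom C a) (Dom C b)))"

definition atom_equiv :: "('o, 'a, 'm) ab_cat_scheme \<Rightarrow> 'o rel" where
  "atom_equiv C = {(H, H'). monoform C H \<and> monoform C H' \<and>
     (\<exists>a b. subobj C H a \<and> subobj C H' b \<and> nonzero_obj C (Dom C a) \<and> nonzero_obj C (Dom C b) \<and>
        isomorphic C (Dom C a) (Dom C b))}"

definition ASpec :: "('o, 'a, 'm) ab_cat_scheme \<Rightarrow> 'o set set" where
  "ASpec C = {H. monoform C H} // atom_equiv C"

definition ASupp :: "('o, 'a, 'm) ab_cat_scheme \<Rightarrow> 'o \<Rightarrow> 'o set set" where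
  "ASupp C M = {\<alpha> \<in> ASpec C. \<exists>H \<in> \<alpha>. subquotient C H M}"

definition atom_open :: "('o, 'a, 'm) ab_cat_scheme \<Rightarrow> 'o set set \<Rightarrow> bool" where
  "atom_open C \<Phi> \<longleftrightarrow> \<Phi> \<subseteq> ASpec C \<and> (\<forall>\<alpha> \<in> \<Phi>. \<exists>H \<in> \<alpha>. ASupp C H \<subseteq> \<Phi>)"

section \<open>Preradicals\<close>

text \<open>
  A subobject of the identity functor is a functor with a natural transformation to the identity
  functor that is a monomorphism of functors; in an abelian category this means that all components
  are monomorphisms.
\<close>

record ('o, 'a) preradical = "('o, 'a, 'o, 'a) cfunctor" +
  Incl :: "'o \<Rightarrow> 'a"

definition is_preradical :: "('o, 'a, 'm) ab_cat_scheme \<Rightarrow> ('o, 'a) preradical \<Rightarrow> bool" where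
  "is_preradical C \<gamma> \<longleftrightarrow> is_functor C C \<gamma> \<and> nat_trans C C \<gamma> id_functor (Incl \<gamma>) \<and>
     (\<forall>M \<in> Obj C. monic C (Incl \<gamma> M))"

definition is_radical :: "('o, 'a, 'm) ab_cat_scheme \<Rightarrow> ('o, 'a) preradical \<Rightarrow> bool" where
  "is_radical C \<gamma> \<longleftrightarrow> is_preradical C \<gamma> \<and>
     (\<forall>M \<in> Obj C. \<forall>q. is_cokernel C (Incl \<gamma> M) q \<longrightarrow> zero_obj C (Fobj \<gamma> (Cod C q)))"

definition preradical_le ::
  "('o, 'a, 'm) ab_cat_scheme \<Rightarrow> ('o, 'a) preradical \<Rightarrow> ('o, 'a) preradical \<Rightarrow> bool" where
  "preradical_le C \<gamma> \<delta> \<longleftrightarrow>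
     (\<exists>\<tau>. nat_trans C C \<gamma> \<delta> \<tau> \<and> (\<forall>M \<in> Obj C. Incl \<delta> M \<cdot>\<^bsub>C\<^esub> \<tau> M = Incl \<gamma> M))"

text \<open>
  Equality of preradicals is equality of subobjects of the identity functor, that is, an isomorphism
  of functors compatible with the inclusions.
\<close>

definition preradical_eq ::
  "('o, 'a, 'm) ab_cat_scheme \<Rightarrow> ('o, 'a) preradical \<Rightarrow> ('o, 'a) preradical \<Rightarrow> bool" where
  "preradical_eq C \<gamma> \<delta> \<longleftrightarrow>
     (\<exists>\<tau>. nat_trans C C \<gamma> \<delta> \<tau> \<and>
        (\<forall>M \<in> Obj C. iso_arr C (\<tau> M) \<and> Incl \<delta> M \<cdot>\<^bsub>C\<^esub> \<tau> M = Incl \<gamma> M))"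

definition torsion_class :: "('o, 'a, 'm) ab_cat_scheme \<Rightarrow> ('o, 'a) preradical \<Rightarrow> 'o set" where
  "torsion_class C \<gamma> = {T \<in> Obj C. iso_arr C (Incl \<gamma> T)}"

definition atoms_of :: "('o, 'a, 'm) ab_cat_scheme \<Rightarrow> ('o, 'a) preradical \<Rightarrow> 'o set set" where
  "atoms_of C \<gamma> = {\<alpha> \<in> ASpec C. \<exists>H \<in> \<alpha>. monoform C H \<and> H \<in> torsion_class C \<gamma>}"

definition is_section_functor ::
  "('o, 'a, 'm) ab_cat_scheme \<Rightarrow> 'o set set \<Rightarrow> ('o, 'a) preradical \<Rightarrow> bool" where
  "is_section_functor C U \<Gamma> \<longleftrightarrow> atom_open C U \<and> is_preradical C \<Gamma> \<and>
     (\<forall>M \<in> Obj C. ASupp C (Fobj \<Gamma> M) \<subseteq> U \<and>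
        (\<forall>n. subobj C M n \<and> ASupp C (Dom C n) \<subseteq> U \<longrightarrow> sub_le C n (Incl \<Gamma> M)))"

text \<open>
  The functor \<open>\<Gamma>\<^sub>U\<close> is unique only up to \<open>preradical_eq\<close>.  The choice below is a section functor only
  if one exists, so statements about \<open>section_functor\<close> contain this existence claim.
\<close>

definition section_functor ::
  "('o, 'a, 'm) ab_cat_scheme \<Rightarrow> 'o set set \<Rightarrow> ('o, 'a) preradical" where
  "section_functor C U = (SOME \<Gamma>. is_section_functor C U \<Gamma>)"

end

(*
  A left exact preradical gamma is idempotent and its torsion class is closed under subquotients, so
  gamma M has atom support in U_gamma.  If gamma is radical and N has atom support in U_gamma, then
  N / gamma N cannot be nonzero: being an object of a locally noetherian category it would contain a
  monoform object, whose atom lies in U_gamma, and hence a nonzero gamma-torsion object.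

  The section functor exists because the subobjects of M with atom support in U are closed under
  finite sums and, by exactness of direct limits, under directed unions, so that there is a largest
  one.
*)
theory Submission
  imports Defs
begin

section \<open>Arrows, kernels and cokernels\<close>

context cat
begin

text \<open>The support arguments never follow a representative \<open>H\<close> of an atom itself.
  When a large object is covered by smaller ones, only a nonzero subobject of \<open>H\<close> can
  be found inside one of them; uniformity of monoform objects keeps that piece in the same atom. To
  find it, \<open>H\<close> is placed inside a quotient \<open>P\<close> of the large object, where
  it can be compared with the image of a smaller object \<open>N\<close>: either \<open>H\<close>
  meets this image, or \<open>H\<close> still embeds into \<open>P\<close> modulo it. For two
  summands this alternative suffices. For a directed family the second case could hold at every
  stage, and exactness of direct limits carries the embeddings to the limit. Two obstacles shape the
  rest. The monomorphisms into an object need not form a small set, so a generator cuts them down to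
  a small family indexed by the type of the universe cardinal. And no elements are available:
  images, preimages and quotients of subobjects are built from kernels and cokernels, starting from
  the normality of monomorphisms and epimorphisms.\<close>

lemma Hom_Obj:
  assumes "f \<in> Hom C X Y"
  shows "X \<in> Obj C" "Y \<in> Obj C"
  using assms Dom_Obj Cod_Obj by (auto simp: Hom_def)

lemma Arr_Hom: "f \<in> Arr C \<Longrightarrow> f \<in> Hom C (Dom C f) (Cod C f)"
  by (simp add: Hom_def)

lemma Hom_Arr: "f \<in> Hom C X Y \<Longrightarrow> f \<in> Arr C"
  by (simp add: Hom_def)

lemma Hom_Dom: "f \<in> Hom C X Y \<Longrightarrow> Dom C f = X"
  by (simp add: Hom_def)

lemma Hom_Cod: "f \<in> Hom C X Y \<Longrightarrow> Cod C f = Y"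
  by (simp add: Hom_def)

lemma Arr_comp: "\<lbrakk>f \<in> Arr C; g \<in> Arr C; Dom C g = Cod C f\<rbrakk> \<Longrightarrow> g \<cdot> f \<in> Arr C"
  and Dom_comp: "\<lbrakk>f \<in> Arr C; g \<in> Arr C; Dom C g = Cod C f\<rbrakk> \<Longrightarrow> Dom C (g \<cdot> f) = Dom C f"
  and Cod_comp: "\<lbrakk>f \<in> Arr C; g \<in> Arr C; Dom C g = Cod C f\<rbrakk> \<Longrightarrow> Cod C (g \<cdot> f) = Cod C g"
  using Comp_Hom[of g "Cod C f" "Cod C g" f "Dom C f"] by (auto simp: Hom_def)

lemmas typing = Hom_def Arr_comp Dom_comp Cod_comp

lemma monicI:
  assumes "m \<in> Hom C X Y"
    and "\<And>W f g. \<lbrakk>f \<in> Hom C W X; g \<in> Hom C W X; m \<cdot> f = m \<cdot> g\<rbrakk> \<Longrightarrow> f = g"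
  shows "monic C m"
  using assms unfolding monic_def by (auto simp: Hom_Arr Hom_Dom)

lemma monicD:
  assumes "monic C m" "m \<in> Hom C X Y" "f \<in> Hom C W X" "g \<in> Hom C W X" "m \<cdot> f = m \<cdot> g"
  shows "f = g"
  using assms unfolding monic_def by (auto simp: Hom_Dom)

lemma monic_Hom: "monic C m \<Longrightarrow> m \<in> Hom C (Dom C m) (Cod C m)"
  by (simp add: monic_def Arr_Hom)

lemma epicI:
  assumes "e \<in> Hom C X Y"
    and "\<And>W f g. \<lbrakk>f \<in> Hom C Y W; g \<in> Hom C Y W; f \<cdot> e = g \<cdot> e\<rbrakk> \<Longrightarrow> f = g"
  shows "epic C e"
  using assms unfolding epic_def by (auto simp: Hom_Arr Hom_Cod)

lemma epicD:
  assumes "epic C e" "e \<in> Hom C X Y" "f \<in> Hom C Y W" "g \<in> Hom C Y W" "f \<cdot> e = g \<cdot> e"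
  shows "f = g"
  using assms unfolding epic_def by (auto simp: Hom_Cod)

lemma epic_Hom: "epic C e \<Longrightarrow> e \<in> Hom C (Dom C e) (Cod C e)"
  by (simp add: epic_def Arr_Hom)

lemma monic_comp:
  assumes "monic C m" "m \<in> Hom C Y Z" "monic C n" "n \<in> Hom C X Y"
  shows "monic C (m \<cdot> n)"
proof (rule monicI)
  show "m \<cdot> n \<in> Hom C X Z" using assms by (simp add: typing)
  fix W f g assume fg: "f \<in> Hom C W X" "g \<in> Hom C W X" "m \<cdot> n \<cdot> f = m \<cdot> n \<cdot> g"
  then have "m \<cdot> (n \<cdot> f) = m \<cdot> (n \<cdot> g)"
    using assms by (simp add: Comp_assoc)
  then have "n \<cdot> f = n \<cdot> g"
    using monicD[OF assms(1,2) Comp_Hom[OF assms(4) fg(1)] Comp_Hom[OF assms(4) fg(2)]] by simp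
  then show "f = g" using monicD[OF assms(3,4) fg(1,2)] by simp
qed

lemma epic_comp:
  assumes "epic C e" "e \<in> Hom C Y Z" "epic C d" "d \<in> Hom C X Y"
  shows "epic C (e \<cdot> d)"
proof (rule epicI)
  show "e \<cdot> d \<in> Hom C X Z" using assms by (simp add: typing)
  fix W f g assume fg: "f \<in> Hom C Z W" "g \<in> Hom C Z W" "f \<cdot> (e \<cdot> d) = g \<cdot> (e \<cdot> d)"
  then have "(f \<cdot> e) \<cdot> d = (g \<cdot> e) \<cdot> d"
    using Comp_assoc[OF fg(1) assms(2,4)] Comp_assoc[OF fg(2) assms(2,4)] by simp
  then have "f \<cdot> e = g \<cdot> e"
    using epicD[OF assms(3,4) Comp_Hom[OF fg(1) assms(2)] Comp_Hom[OF fg(2) assms(2)]] by simp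
  then show "f = g" using epicD[OF assms(1,2) fg(1,2)] by simp
qed

lemma monic_right:
  assumes "monic C (m \<cdot> n)" "m \<in> Hom C Y Z" "n \<in> Hom C X Y"
  shows "monic C n"
  using assms(3)
proof (rule monicI)
  fix W f g assume fg: "f \<in> Hom C W X" "g \<in> Hom C W X" "n \<cdot> f = n \<cdot> g"
  then have "m \<cdot> n \<cdot> f = m \<cdot> n \<cdot> g"
    using Comp_assoc[OF assms(2,3) fg(1)] Comp_assoc[OF assms(2,3) fg(2)] by simp
  then show "f = g" using monicD[OF assms(1) Comp_Hom[OF assms(2,3)] fg(1,2)] by simp
qed

lemma epic_left:
  assumes "epic C (e \<cdot> d)" "e \<in> Hom C Y Z" "d \<in> Hom C X Y"
  shows "epic C e"
  using assms(2)
proof (rule epicI)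
  fix W f g assume fg: "f \<in> Hom C Z W" "g \<in> Hom C Z W" "f \<cdot> e = g \<cdot> e"
  then have "f \<cdot> (e \<cdot> d) = g \<cdot> (e \<cdot> d)"
    using Comp_assoc[OF fg(1) assms(2,3)] Comp_assoc[OF fg(2) assms(2,3)] by simp
  then show "f = g" using epicD[OF assms(1) Comp_Hom[OF assms(2,3)] fg(1,2)] by simp
qed

lemma iso_arrI:
  assumes "f \<in> Hom C X Y" "g \<in> Hom C Y X" "g \<cdot> f = Idn C X" "f \<cdot> g = Idn C Y"
  shows "iso_arr C f"
  using assms unfolding iso_arr_def Hom_def by auto

lemma iso_arrE:
  assumes "iso_arr C f" "f \<in> Hom C X Y"
  obtains g where "g \<in> Hom C Y X" "g \<cdot> f = Idn C X" "f \<cdot> g = Idn C Y"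
  using assms unfolding iso_arr_def Hom_def by auto

lemma monic_Idn: "X \<in> Obj C \<Longrightarrow> monic C (Idn C X)"
  by (rule monicI[OF Idn_Hom]) (auto simp: Idn_Comp)

lemma epic_Idn: "X \<in> Obj C \<Longrightarrow> epic C (Idn C X)"
  by (rule epicI[OF Idn_Hom]) (auto simp: Comp_Idn)

lemma split_monic:
  assumes "f \<in> Hom C X Y" "g \<in> Hom C Y X" "g \<cdot> f = Idn C X"
  shows "monic C f"
  using assms monic_right monic_Idn Hom_Obj by metis

lemma split_epic:
  assumes "f \<in> Hom C X Y" "g \<in> Hom C Y X" "f \<cdot> g = Idn C Y"
  shows "epic C f"
  using assms epic_left epic_Idn Hom_Obj by metis

lemma iso_monic: "\<lbrakk>iso_arr C f; f \<in> Hom C X Y\<rbrakk> \<Longrightarrow> monic C f"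
  using iso_arrE split_monic by metis

lemma iso_epic: "\<lbrakk>iso_arr C f; f \<in> Hom C X Y\<rbrakk> \<Longrightarrow> epic C f"
  using iso_arrE split_epic by metis

lemma monic_split_iso:
  assumes "monic C m" "m \<in> Hom C X Y" "s \<in> Hom C Y X" "m \<cdot> s = Idn C Y"
  shows "iso_arr C m"
proof (rule iso_arrI)
  have "m \<cdot> (s \<cdot> m) = m \<cdot> Idn C X"
    using assms Comp_assoc Comp_Idn Idn_Comp by metis
  then show "s \<cdot> m = Idn C X"
    using monicD[OF assms(1,2) Comp_Hom[OF assms(3,2)] Idn_Hom] assms(2) Hom_Obj by blast
qed (use assms in auto)

end

section \<open>Zero morphisms, kernels and cokernels in preadditive categories\<close>

context preadditive_cat
begin

lemma
  Hom_group: "\<lbrakk>X \<in> Obj C; Y \<in> Obj C\<rbrakk> \<Longrightarrow> group (Hom_group C X Y)"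
  using Hom_comm_group comm_group.axioms(2) by blast

lemma
  Zer_Hom: "\<lbrakk>X \<in> Obj C; Y \<in> Obj C\<rbrakk> \<Longrightarrow> Zer C X Y \<in> Hom C X Y"
  using monoid.one_closed[OF group.is_monoid[OF Hom_group[of X Y]]]
  by (auto simp: Hom_group_def)

lemma Add_Hom: "\<lbrakk>f \<in> Hom C X Y; g \<in> Hom C X Y\<rbrakk> \<Longrightarrow> f \<boxplus> g \<in> Hom C X Y"
  using monoid.m_closed[OF group.is_monoid[OF Hom_group[of X Y]]] Hom_Obj
  by (auto simp: Hom_group_def)

text \<open>In a group only the neutral element is idempotent; bilinearity makes a composite with a
  zero morphism idempotent, which is how such composites are shown to vanish.\<close>

lemma Add_idem_Zer:
  assumes "f \<in> Hom C X Y" "f \<boxplus> f = f"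
  shows "f = Zer C X Y"
proof -
  interpret group "Hom_group C X Y" using Hom_group Hom_Obj assms by blast
  show ?thesis using assms l_cancel_one[of f f] by (simp add: Hom_group_def)
qed

lemma Zer_Add: "f \<in> Hom C X Y \<Longrightarrow> Zer C X Y \<boxplus> f = f"
  using monoid.l_one[OF group.is_monoid[OF Hom_group[of X Y]]] Hom_Obj
  by (auto simp: Hom_group_def)

lemma Add_Zer: "f \<in> Hom C X Y \<Longrightarrow> f \<boxplus> Zer C X Y = f"
  using monoid.r_one[OF group.is_monoid[OF Hom_group[of X Y]]] Hom_Obj
  by (auto simp: Hom_group_def)

lemma Comp_Zer:
  assumes "f \<in> Hom C Y Z" "X \<in> Obj C"
  shows "f \<cdot> Zer C X Y = Zer C X Z"
proof (rule Add_idem_Zer)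
  have z: "Zer C X Y \<in> Hom C X Y" using assms Zer_Hom Hom_Obj by blast
  show "f \<cdot> Zer C X Y \<in> Hom C X Z" using z assms by (simp add: typing)
  show "f \<cdot> Zer C X Y \<boxplus> f \<cdot> Zer C X Y = f \<cdot> Zer C X Y"
    using Comp_Add[OF assms(1) z z] Zer_Add[OF z] by simp
qed

lemma Zer_Comp:
  assumes "f \<in> Hom C X Y" "Z \<in> Obj C"
  shows "Zer C Y Z \<cdot> f = Zer C X Z"
proof (rule Add_idem_Zer)
  have z: "Zer C Y Z \<in> Hom C Y Z" using assms Zer_Hom Hom_Obj by blast
  show "Zer C Y Z \<cdot> f \<in> Hom C X Z" using z assms by (simp add: typing)
  show "Zer C Y Z \<cdot> f \<boxplus> Zer C Y Z \<cdot> f = Zer C Y Z \<cdot> f"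
    using Add_Comp[OF z z assms(1)] Zer_Add[OF z] by simp
qed

lemma monic_zeroI:
  assumes f: "f \<in> Hom C X Y"
    and inj: "\<And>W g. \<lbrakk>g \<in> Hom C W X; f \<cdot> g = Zer C W Y\<rbrakk> \<Longrightarrow> g = Zer C W X"
  shows "monic C f"
  using f
proof (rule monicI)
  fix W g h assume gh: "g \<in> Hom C W X" "h \<in> Hom C W X" and eq: "f \<cdot> g = f \<cdot> h"
  interpret group "Hom_group C W X" using Hom_group Hom_Obj gh by blast
  \<comment> \<open>\<open>k\<close> is the additive inverse of \<open>h\<close>, taken from the
    group since the category record carries no negation; \<open>g \<boxplus> k\<close> is the
    difference.\<close>
  obtain k where k: "k \<in> Hom C W X" "h \<boxplus> k = Zer C W X"
    using r_inv_ex[of h] gh by (auto simp: Hom_group_def)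
  have "f \<cdot> (g \<boxplus> k) = f \<cdot> (h \<boxplus> k)" using f gh k eq Comp_Add by metis
  also have "\<dots> = Zer C W Y" using k f gh Comp_Zer Hom_Obj by metis
  finally have "g \<boxplus> k = Zer C W X" using inj Add_Hom gh k by blast
  then show "g = h" using k gh right_cancel[of k g h] by (simp add: Hom_group_def)
qed

lemma epic_zeroI:
  assumes f: "f \<in> Hom C X Y"
    and inj: "\<And>W g. \<lbrakk>g \<in> Hom C Y W; g \<cdot> f = Zer C X W\<rbrakk> \<Longrightarrow> g = Zer C Y W"
  shows "epic C f"
  using f
proof (rule epicI)
  fix W g h assume gh: "g \<in> Hom C Y W" "h \<in> Hom C Y W" and eq: "g \<cdot> f = h \<cdot> f"
  interpret group "Hom_group C Y W" using Hom_group Hom_Obj gh by blast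
  obtain k where k: "k \<in> Hom C Y W" "h \<boxplus> k = Zer C Y W"
    using r_inv_ex[of h] gh by (auto simp: Hom_group_def)
  have "(g \<boxplus> k) \<cdot> f = (h \<boxplus> k) \<cdot> f" using f gh k eq Add_Comp by metis
  also have "\<dots> = Zer C X W" using k f gh Zer_Comp Hom_Obj by metis
  finally have "g \<boxplus> k = Zer C Y W" using inj Add_Hom gh k by blast
  then show "g = h" using k gh right_cancel[of k g h] by (simp add: Hom_group_def)
qed

lemma monic_zeroD:
  assumes "monic C m" "m \<in> Hom C X Y" "g \<in> Hom C W X" "m \<cdot> g = Zer C W Y"
  shows "g = Zer C W X"
  using monicD[OF assms(1,2,3) Zer_Hom] assms Comp_Zer Hom_Obj by metis

lemma epic_zeroD:
  assumes "epic C e" "e \<in> Hom C X Y" "g \<in> Hom C Y W" "g \<cdot> e = Zer C X W"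
  shows "g = Zer C Y W"
  using epicD[OF assms(1,2,3) Zer_Hom] assms Zer_Comp Hom_Obj by metis

lemma zero_obj_iff:
  assumes "X \<in> Obj C"
  shows "zero_obj C X \<longleftrightarrow> Idn C X = Zer C X X"
proof
  assume "zero_obj C X"
  then show "Idn C X = Zer C X X"
    using assms Idn_Hom Zer_Hom unfolding zero_obj_def by metis
next
  assume eq: "Idn C X = Zer C X X"
  have "f = Zer C Y X" if "f \<in> Hom C Y X" for f Y
    using that eq Idn_Comp Zer_Comp assms by metis
  moreover have "f = Zer C X Y" if "f \<in> Hom C X Y" for f Y
    using that eq Comp_Idn Comp_Zer assms by metis
  ultimately show "zero_obj C X" unfolding zero_obj_def using assms Zer_Hom by metis
qed

lemma nonzero_objI: "\<lbrakk>f \<in> Hom C X Y; f \<noteq> Zer C X Y\<rbrakk> \<Longrightarrow> nonzero_obj C X \<and> nonzero_obj C Y"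
  unfolding nonzero_obj_def using zero_obj_iff Comp_Idn Idn_Comp Comp_Zer Zer_Comp Hom_Obj by metis

lemma monic_nonzero:
  assumes "monic C m" "m \<in> Hom C X Y" "nonzero_obj C X"
  shows "m \<noteq> Zer C X Y"
proof
  assume "m = Zer C X Y"
  then have "m \<cdot> Idn C X = Zer C X Y" using assms Comp_Idn by metis
  then have "Idn C X = Zer C X X" using monic_zeroD assms Idn_Hom Hom_Obj by metis
  then show False using assms zero_obj_iff by (auto simp: nonzero_obj_def)
qed

lemma epic_nonzero:
  assumes "epic C e" "e \<in> Hom C X Y" "nonzero_obj C Y"
  shows "e \<noteq> Zer C X Y"
proof
  assume "e = Zer C X Y"
  then have "Idn C Y \<cdot> e = Zer C X Y" using assms Idn_Comp by metis
  then have "Idn C Y = Zer C Y Y" using epic_zeroD assms Idn_Hom Hom_Obj by metis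
  then show False using assms zero_obj_iff by (auto simp: nonzero_obj_def)
qed

lemma kernelD:
  assumes "is_kernel C f k" "f \<in> Hom C X Y"
  shows "k \<in> Hom C (Dom C k) X" "f \<cdot> k = Zer C (Dom C k) Y" "monic C k"
proof -
  show k: "k \<in> Hom C (Dom C k) X" and fk: "f \<cdot> k = Zer C (Dom C k) Y"
    using assms by (auto simp: is_kernel_def Hom_def)
  show "monic C k"
    using k
  proof (rule monicI)
    fix W g h assume gh: "g \<in> Hom C W (Dom C k)" "h \<in> Hom C W (Dom C k)" "k \<cdot> g = k \<cdot> h"
    have "f \<cdot> (k \<cdot> g) = Zer C W Y"
      using Comp_assoc[OF assms(2) k gh(1)] fk Zer_Comp[OF gh(1)] Hom_Obj[OF assms(2)] by simp
    moreover have "k \<cdot> g \<in> Hom C W X" using k gh by (simp add: typing)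
    ultimately have "\<exists>!u. u \<in> Hom C W (Dom C k) \<and> k \<cdot> u = k \<cdot> g"
      using assms unfolding is_kernel_def by (auto simp: Hom_Dom Hom_Cod)
    then show "g = h" using gh by metis
  qed
qed

lemma kernel_factor:
  assumes "is_kernel C f k" "f \<in> Hom C X Y" "h \<in> Hom C W X" "f \<cdot> h = Zer C W Y"
  obtains u where "u \<in> Hom C W (Dom C k)" "k \<cdot> u = h"
proof -
  have "\<exists>!u. u \<in> Hom C W (Dom C k) \<and> k \<cdot> u = h"
    using assms unfolding is_kernel_def by (auto simp: Hom_Dom[OF assms(2)] Hom_Cod[OF assms(2)])
  then show ?thesis using that by blast
qed

lemma cokernelD:
  assumes "is_cokernel C f q" "f \<in> Hom C X Y"
  shows "q \<in> Hom C Y (Cod C q)" "q \<cdot> f = Zer C X (Cod C q)" "epic C q"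
proof -
  show q: "q \<in> Hom C Y (Cod C q)" and qf: "q \<cdot> f = Zer C X (Cod C q)"
    using assms by (auto simp: is_cokernel_def Hom_def)
  show "epic C q"
    using q
  proof (rule epicI)
    fix W g h assume gh: "g \<in> Hom C (Cod C q) W" "h \<in> Hom C (Cod C q) W" "g \<cdot> q = h \<cdot> q"
    have "(g \<cdot> q) \<cdot> f = Zer C X W"
      using Comp_assoc[OF gh(1) q assms(2)] qf Comp_Zer[OF gh(1)] Hom_Obj[OF assms(2)] by simp
    moreover have "g \<cdot> q \<in> Hom C Y W" using q gh by (simp add: typing)
    ultimately have "\<exists>!u. u \<in> Hom C (Cod C q) W \<and> u \<cdot> q = g \<cdot> q"
      using assms unfolding is_cokernel_def by (auto simp: Hom_Dom Hom_Cod)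
    then show "g = h" using gh by metis
  qed
qed

lemma cokernel_factor:
  assumes "is_cokernel C f q" "f \<in> Hom C X Y" "h \<in> Hom C Y W" "h \<cdot> f = Zer C X W"
  obtains u where "u \<in> Hom C (Cod C q) W" "u \<cdot> q = h"
proof -
  have "\<exists>!u. u \<in> Hom C (Cod C q) W \<and> u \<cdot> q = h"
    using assms unfolding is_cokernel_def by (auto simp: Hom_Dom[OF assms(2)] Hom_Cod[OF assms(2)])
  then show ?thesis using that by blast
qed

lemma kernelI:
  assumes "monic C k" "k \<in> Hom C K X" "f \<in> Hom C X Y" "f \<cdot> k = Zer C K Y"
    and "\<And>W h. \<lbrakk>h \<in> Hom C W X; f \<cdot> h = Zer C W Y\<rbrakk> \<Longrightarrow> \<exists>u \<in> Hom C W K. k \<cdot> u = h"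
  shows "is_kernel C f k"
  unfolding is_kernel_def
proof (intro conjI allI ballI impI)
  fix W h assume h: "h \<in> Hom C W (Dom C f)" "f \<cdot> h = Zer C W (Cod C f)"
  then obtain u where "u \<in> Hom C W K" "k \<cdot> u = h" using assms by (metis Hom_Dom Hom_Cod)
  then show "\<exists>!u. u \<in> Hom C W (Dom C k) \<and> k \<cdot> u = h"
    using monicD[OF assms(1,2)] assms(2) by (metis Hom_Dom)
qed (use assms in \<open>auto simp: Hom_def\<close>)

lemma cokernelI:
  assumes "epic C q" "q \<in> Hom C Y Q" "f \<in> Hom C X Y" "q \<cdot> f = Zer C X Q"
    and "\<And>W h. \<lbrakk>h \<in> Hom C Y W; h \<cdot> f = Zer C X W\<rbrakk> \<Longrightarrow> \<exists>u \<in> Hom C Q W. u \<cdot> q = h"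
  shows "is_cokernel C f q"
  unfolding is_cokernel_def
proof (intro conjI allI ballI impI)
  fix W h assume h: "h \<in> Hom C (Cod C f) W" "h \<cdot> f = Zer C (Dom C f) W"
  then obtain u where "u \<in> Hom C Q W" "u \<cdot> q = h" using assms by (metis Hom_Dom Hom_Cod)
  then show "\<exists>!u. u \<in> Hom C (Cod C q) W \<and> u \<cdot> q = h"
    using epicD[OF assms(1,2)] assms(2) by (metis Hom_Cod)
qed (use assms in \<open>auto simp: Hom_def\<close>)

end

section \<open>Abelian categories and monoform objects\<close>

text \<open>Records only that a monomorphism exists. A pair of subobjects with isomorphic domains,
  as in the definitions of monoform objects and atom equivalence, then becomes a single object
  embedding into both sides.\<close>

definition embeds :: "('o, 'a, 'm) cat_scheme \<Rightarrow> 'o \<Rightarrow> 'o \<Rightarrow> bool" where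
  "embeds C X Y \<longleftrightarrow> (\<exists>m \<in> Hom C X Y. monic C m)"

context cat
begin

lemma embeds_trans: "\<lbrakk>embeds C X Y; embeds C Y Z\<rbrakk> \<Longrightarrow> embeds C X Z"
  unfolding embeds_def using monic_comp Comp_Hom by metis

lemma embeds_refl: "X \<in> Obj C \<Longrightarrow> embeds C X X"
  unfolding embeds_def using monic_Idn Idn_Hom by blast

text \<open>For precomposing a naturality square with a further morphism.\<close>

lemma Comp_Comp_eq:
  assumes "a \<cdot> b = c \<cdot> d" "b \<in> Hom C X Y" "a \<in> Hom C Y Z" "d \<in> Hom C X Y'" "c \<in> Hom C Y' Z"
    and "x \<in> Hom C W X"
  shows "a \<cdot> (b \<cdot> x) = c \<cdot> (d \<cdot> x)"
  using Comp_assoc[OF assms(3,2,6)] Comp_assoc[OF assms(5,4,6)] assms(1) by simp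

end

section \<open>Images, preimages and quotients in abelian categories\<close>

context abelian_cat
begin

lemma kernel_exists:
  assumes "f \<in> Hom C X Y"
  obtains K k where "is_kernel C f k" "k \<in> Hom C K X" "monic C k" "f \<cdot> k = Zer C K Y"
proof -
  obtain k where "is_kernel C f k" using ex_kernel assms Hom_Arr by blast
  then show ?thesis using that kernelD[OF _ assms] by blast
qed

lemma cokernel_exists:
  assumes "f \<in> Hom C X Y"
  obtains Q q where "is_cokernel C f q" "q \<in> Hom C Y Q" "epic C q" "q \<cdot> f = Zer C X Q"
proof -
  obtain q where "is_cokernel C f q" using ex_cokernel assms Hom_Arr by blast
  then show ?thesis using that cokernelD[OF _ assms] by blast
qed

text \<open>Normality gives \<open>m\<close> as the kernel of some \<open>f\<close>; this
  \<open>f\<close> factors through the cokernel \<open>c\<close>, so everything killed by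
  \<open>c\<close> is killed by \<open>f\<close>.\<close>

lemma monic_is_kernel:
  assumes m: "monic C m" "m \<in> Hom C X Y" and c: "is_cokernel C m c"
  shows "is_kernel C c m"
proof -
  obtain f where f: "is_kernel C f m" using monic_normal m by blast
  then obtain Z where fH: "f \<in> Hom C Y Z"
    using m(2) by (auto simp: is_kernel_def Hom_def)
  have cH: "c \<in> Hom C Y (Cod C c)" and cm: "c \<cdot> m = Zer C X (Cod C c)"
    using cokernelD[OF c m(2)] by auto
  have "f \<cdot> m = Zer C X Z" using kernelD(2)[OF f fH] m(2) Hom_Dom by metis
  then obtain y where y: "y \<in> Hom C (Cod C c) Z" "y \<cdot> c = f"
    using cokernel_factor[OF c m(2) fH] by blast
  show ?thesis
  proof (rule kernelI[OF m cH cm])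
    fix W h assume h: "h \<in> Hom C W Y" "c \<cdot> h = Zer C W (Cod C c)"
    have "f \<cdot> h = Zer C W Z"
      using Comp_assoc[OF y(1) cH h(1)] y h Comp_Zer[OF y(1)] Hom_Obj[OF h(1)] by simp
    then show "\<exists>u \<in> Hom C W X. m \<cdot> u = h"
      using kernel_factor[OF f fH h(1)] m(2) Hom_Dom by metis
  qed
qed

lemma epic_is_cokernel:
  assumes e: "epic C e" "e \<in> Hom C X Y" and k: "is_kernel C e k"
  shows "is_cokernel C k e"
proof -
  obtain f where f: "is_cokernel C f e" using epic_normal e by blast
  then obtain Z where fH: "f \<in> Hom C Z X"
    using e(2) by (auto simp: is_cokernel_def Hom_def)
  have kH: "k \<in> Hom C (Dom C k) X" and ek: "e \<cdot> k = Zer C (Dom C k) Y"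
    using kernelD[OF k e(2)] by auto
  have "e \<cdot> f = Zer C Z Y" using cokernelD(2)[OF f fH] e(2) Hom_Cod by metis
  then obtain y where y: "y \<in> Hom C Z (Dom C k)" "k \<cdot> y = f"
    using kernel_factor[OF k e(2) fH] by blast
  show ?thesis
  proof (rule cokernelI[OF e kH ek])
    fix W h assume h: "h \<in> Hom C X W" "h \<cdot> k = Zer C (Dom C k) W"
    have "h \<cdot> f = Zer C Z W"
      using Comp_assoc[OF h(1) kH y(1)] y h Zer_Comp[OF y(1)] Hom_Obj[OF h(1)] by simp
    then show "\<exists>u \<in> Hom C Y W. u \<cdot> e = h"
      using cokernel_factor[OF f fH h(1)] e(2) Hom_Cod by metis
  qed
qed

text \<open>The image is the kernel \<open>m\<close> of the cokernel \<open>q\<close> of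
  \<open>f\<close>. That the other factor is epic rests on the minimality of \<open>m\<close>: no
  proper subobject of it can carry \<open>f\<close>.\<close>

lemma image_exists:
  assumes f: "f \<in> Hom C X Y"
  obtains I e m
    where "epic C e" "e \<in> Hom C X I" "monic C m" "m \<in> Hom C I Y" "f = m \<cdot> e"
proof -
  obtain Q q where q: "is_cokernel C f q" "q \<in> Hom C Y Q" "epic C q" "q \<cdot> f = Zer C X Q"
    using cokernel_exists[OF f] .
  obtain I m where m: "is_kernel C q m" "m \<in> Hom C I Y" "monic C m" "q \<cdot> m = Zer C I Q"
    using kernel_exists[OF q(2)] .
  obtain e where e: "e \<in> Hom C X I" "m \<cdot> e = f"
    using kernel_factor[OF m(1) q(2) f q(4)] m(2) Hom_Dom by metis
  have "epic C e"
    using e(1)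
  proof (rule epic_zeroI)
    fix W g assume g: "g \<in> Hom C I W" "g \<cdot> e = Zer C X W"
    obtain K k where k: "is_kernel C g k" "k \<in> Hom C K I" "monic C k" "g \<cdot> k = Zer C K W"
      using kernel_exists[OF g(1)] .
    obtain e' where e': "e' \<in> Hom C X K" "k \<cdot> e' = e"
      using kernel_factor[OF k(1) g(1) e(1) g(2)] k(2) Hom_Dom by metis
    \<comment> \<open>\<open>f\<close> still factors through the smaller monomorphism
      \<open>m \<cdot> k\<close>. Its cokernel \<open>x\<close> therefore vanishes on
      \<open>f\<close>, factors through \<open>q\<close> and vanishes on \<open>m\<close>. So
      \<open>m\<close> factors back through \<open>m \<cdot> k\<close>, which makes \<open>k\<close>
      split epic and \<open>g\<close> zero.\<close>
    have mk: "monic C (m \<cdot> k)" "m \<cdot> k \<in> Hom C K Y"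
      using monic_comp m k Comp_Hom by metis+
    obtain Z x
      where x: "is_cokernel C (m \<cdot> k) x" "x \<in> Hom C Y Z" "x \<cdot> (m \<cdot> k) = Zer C K Z"
      using cokernel_exists[OF mk(2)] by metis
    have "f = (m \<cdot> k) \<cdot> e'" using Comp_assoc[OF m(2) k(2) e'(1)] e e' by simp
    then have "x \<cdot> f = Zer C X Z"
      using Comp_assoc[OF x(2) mk(2) e'(1)] x(3) Zer_Comp[OF e'(1)] Hom_Obj[OF x(2)] by simp
    then obtain y where y: "y \<in> Hom C Q Z" "y \<cdot> q = x"
      using cokernel_factor[OF q(1) f x(2)] q(2) Hom_Cod by metis
    have "x \<cdot> m = Zer C I Z"
      using Comp_assoc[OF y(1) q(2) m(2)] y m(4) Comp_Zer[OF y(1)] Hom_Obj[OF m(2)] by simp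
    then obtain z where z: "z \<in> Hom C I K" "(m \<cdot> k) \<cdot> z = m"
      using kernel_factor[OF monic_is_kernel[OF mk x(1)] x(2) m(2)] mk(2) Hom_Dom by metis
    have I: "I \<in> Obj C" using Hom_Obj[OF m(2)] by blast
    have "m \<cdot> (k \<cdot> z) = m \<cdot> Idn C I"
      using Comp_assoc[OF m(2) k(2) z(1)] z(2) Comp_Idn[OF m(2)] by simp
    then have "k \<cdot> z = Idn C I"
      using monicD[OF m(3,2) Comp_Hom[OF k(2) z(1)] Idn_Hom[OF I]] by simp
    then have "g = (g \<cdot> k) \<cdot> z"
      using Comp_assoc[OF g(1) k(2) z(1)] Comp_Idn[OF g(1)] by simp
    then show "g = Zer C I W" using k(4) Zer_Comp[OF z(1)] Hom_Obj[OF g(1)] by simp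
  qed
  then show ?thesis using that e m by blast
qed

text \<open>An epic monomorphism is the kernel of a zero morphism, so the identity of its codomain
  factors through it.\<close>

lemma monic_epic_iso:
  assumes m: "monic C m" "m \<in> Hom C X Y" and e: "epic C m"
  shows "iso_arr C m"
proof -
  obtain Q q where q: "is_cokernel C m q" "q \<in> Hom C Y Q" "q \<cdot> m = Zer C X Q"
    using cokernel_exists[OF m(2)] by metis
  have Y: "Y \<in> Obj C" using Hom_Obj[OF m(2)] by blast
  have "q = Zer C Y Q" using epic_zeroD[OF e m(2) q(2,3)] .
  then have "q \<cdot> Idn C Y = Zer C Y Q" using Comp_Idn[OF q(2)] by simp
  then obtain s where "s \<in> Hom C Y X" "m \<cdot> s = Idn C Y"
    using kernel_factor[OF monic_is_kernel[OF m q(1)] q(2) Idn_Hom[OF Y]] m(2) Hom_Dom by metis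
  then show ?thesis using monic_split_iso[OF m] by blast
qed

text \<open>The preimage of \<open>L\<close> under \<open>e\<close> is built as the kernel of
  \<open>c \<cdot> e\<close>, with \<open>c\<close> the cokernel of \<open>m\<close>. It still
  covers \<open>L\<close>, because the cokernel of a smaller image of \<open>d\<close> already
  vanishes on \<open>L\<close>.\<close>

lemma pullback_epic:
  assumes m: "monic C m" "m \<in> Hom C L Q" and e: "epic C e" "e \<in> Hom C M Q"
  obtains L' k d
    where "monic C k" "k \<in> Hom C L' M" "epic C d" "d \<in> Hom C L' L" "m \<cdot> d = e \<cdot> k"
proof -
  obtain R c where c: "is_cokernel C m c" "c \<in> Hom C Q R" "epic C c" "c \<cdot> m = Zer C L R"
    using cokernel_exists[OF m(2)] .
  have ce: "epic C (c \<cdot> e)" "c \<cdot> e \<in> Hom C M R"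
    using epic_comp c e Comp_Hom by metis+
  obtain L' k
    where k: "is_kernel C (c \<cdot> e) k" "k \<in> Hom C L' M" "monic C k" "c \<cdot> e \<cdot> k = Zer C L' R"
    using kernel_exists[OF ce(2)] .
  have ek: "e \<cdot> k \<in> Hom C L' Q" using e k Comp_Hom by metis
  have "c \<cdot> (e \<cdot> k) = Zer C L' R" using Comp_assoc[OF c(2) e(2) k(2)] k(4) by simp
  then obtain d where d: "d \<in> Hom C L' L" "m \<cdot> d = e \<cdot> k"
    using kernel_factor[OF monic_is_kernel[OF m c(1)] c(2) ek] m(2) Hom_Dom by metis
  obtain I b i
    where i: "epic C b" "b \<in> Hom C L' I" "monic C i" "i \<in> Hom C I L" "d = i \<cdot> b"
    using image_exists[OF d(1)] .
  have mi: "monic C (m \<cdot> i)" "m \<cdot> i \<in> Hom C I Q"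
    using monic_comp m i Comp_Hom by metis+
  obtain Y y
    where y: "is_cokernel C (m \<cdot> i) y" "y \<in> Hom C Q Y" "y \<cdot> (m \<cdot> i) = Zer C I Y"
    using cokernel_exists[OF mi(2)] by metis
  have ye: "y \<cdot> e \<in> Hom C M Y" using y e Comp_Hom by metis
  \<comment> \<open>\<open>c \<cdot> e\<close> is the cokernel of its kernel \<open>k\<close>. So
    \<open>y \<cdot> e\<close>, which vanishes on \<open>k\<close>, factors through it, and
    cancelling \<open>e\<close> shows that \<open>y\<close> factors through \<open>c\<close> and
    vanishes on \<open>m\<close>.\<close>
  have "y \<cdot> e \<cdot> k = y \<cdot> (m \<cdot> i \<cdot> b)"
    using Comp_assoc[OF y(2) e(2) k(2)] Comp_assoc[OF m(2) i(4,2)] d(2) i(5) by simp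
  also have "\<dots> = Zer C L' Y"
    using Comp_assoc[OF y(2) mi(2) i(2)] y(3) Zer_Comp[OF i(2)] Hom_Obj[OF y(2)] by simp
  finally obtain z where z: "z \<in> Hom C R Y" "z \<cdot> (c \<cdot> e) = y \<cdot> e"
    using cokernel_factor[OF epic_is_cokernel[OF ce k(1)] k(2) ye] ce(2) Hom_Cod by metis
  have "z \<cdot> c \<cdot> e = y \<cdot> e" using Comp_assoc[OF z(1) c(2) e(2)] z by simp
  then have "z \<cdot> c = y" using epicD[OF e Comp_Hom[OF z(1) c(2)] y(2)] by simp
  then have "y \<cdot> m = Zer C L Y"
    using Comp_assoc[OF z(1) c(2) m(2)] c(4) Comp_Zer[OF z(1)] Hom_Obj[OF m(2)] by simp
  then obtain w where w: "w \<in> Hom C L I" "m \<cdot> i \<cdot> w = m"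
    using kernel_factor[OF monic_is_kernel[OF mi y(1)] y(2) m(2)] mi(2) Hom_Dom by metis
  have L: "L \<in> Obj C" using Hom_Obj[OF m(2)] by blast
  have "m \<cdot> (i \<cdot> w) = m \<cdot> Idn C L"
    using Comp_assoc[OF m(2) i(4) w(1)] w(2) Comp_Idn[OF m(2)] by simp
  then have "i \<cdot> w = Idn C L"
    using monicD[OF m Comp_Hom[OF i(4) w(1)] Idn_Hom[OF L]] by simp
  then have "epic C i" using split_epic[OF i(4) w(1)] by simp
  then have "epic C d" using epic_comp[OF _ i(4,1,2)] i(5) by simp
  then show ?thesis using that k d by blast
qed

text \<open>This is the induced map from \<open>L/K\<close> to \<open>M/K\<close>: whatever of
  \<open>L\<close> it kills lies in \<open>K\<close>, which \<open>e\<close> kills already.\<close>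

lemma pushout_monic:
  assumes l: "monic C l" "l \<in> Hom C L M" and e: "epic C e" "e \<in> Hom C L H"
    and k: "is_kernel C e k" "k \<in> Hom C K L"
    and p: "is_cokernel C (l \<cdot> k) p" "p \<in> Hom C M P"
  obtains h where "monic C h" "h \<in> Hom C H P" "h \<cdot> e = p \<cdot> l"
proof -
  have lk: "monic C (l \<cdot> k)" "l \<cdot> k \<in> Hom C K M"
    using monic_comp[OF l _ k(2)] kernelD[OF k(1) e(2)] Comp_Hom[OF l(2) k(2)] by auto
  have pl: "p \<cdot> l \<in> Hom C L P" using Comp_Hom[OF p(2) l(2)] .
  have "p \<cdot> l \<cdot> k = Zer C K P"
    using Comp_assoc[OF p(2) l(2) k(2)] cokernelD(2)[OF p(1) lk(2)] Hom_Cod[OF p(2)] by simp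
  then obtain h where h: "h \<in> Hom C H P" "h \<cdot> e = p \<cdot> l"
    using cokernel_factor[OF epic_is_cokernel[OF e k(1)] k(2) pl] e(2) Hom_Cod by metis
  obtain I j i
    where i: "epic C j" "j \<in> Hom C H I" "monic C i" "i \<in> Hom C I P" "h = i \<cdot> j"
    using image_exists[OF h(1)] .
  have je: "epic C (j \<cdot> e)" "j \<cdot> e \<in> Hom C L I"
    using epic_comp i e Comp_Hom by metis+
  obtain Y y
    where y: "is_kernel C (j \<cdot> e) y" "y \<in> Hom C Y L" "j \<cdot> e \<cdot> y = Zer C Y I"
    using kernel_exists[OF je(2)] by metis
  have ly: "l \<cdot> y \<in> Hom C Y M" using l y Comp_Hom by metis
  have "p \<cdot> (l \<cdot> y) = i \<cdot> (j \<cdot> e) \<cdot> y"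
    using Comp_assoc[OF p(2) l(2) y(2)] Comp_assoc[OF i(4,2) e(2)] h(2) i(5) by simp
  also have "\<dots> = Zer C Y P"
    using Comp_assoc[OF i(4) je(2) y(2)] y(3) Comp_Zer[OF i(4)] Hom_Obj[OF y(2)] by simp
  finally obtain z where z: "z \<in> Hom C Y K" "l \<cdot> k \<cdot> z = l \<cdot> y"
    using kernel_factor[OF monic_is_kernel[OF lk p(1)] p(2) ly] lk(2) Hom_Dom by metis
  have "l \<cdot> (k \<cdot> z) = l \<cdot> y" using Comp_assoc[OF l(2) k(2) z(1)] z by simp
  then have kz: "k \<cdot> z = y" using monicD[OF l Comp_Hom[OF k(2) z(1)] y(2)] by simp
  have "e \<cdot> k = Zer C K H" using kernelD(2)[OF k(1) e(2)] Hom_Dom[OF k(2)] by simp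
  then have "e \<cdot> y = Zer C Y H"
    using Comp_assoc[OF e(2) k(2) z(1)] kz Zer_Comp[OF z(1)] Hom_Obj[OF e(2)] by simp
  then obtain w where w: "w \<in> Hom C I H" "w \<cdot> (j \<cdot> e) = e"
    using cokernel_factor[OF epic_is_cokernel[OF je y(1)] y(2) e(2)] je(2) Hom_Cod by metis
  have H: "H \<in> Obj C" using Hom_Obj[OF e(2)] by blast
  have "w \<cdot> j \<cdot> e = Idn C H \<cdot> e"
    using Comp_assoc[OF w(1) i(2) e(2)] w(2) Idn_Comp[OF e(2)] by simp
  then have "w \<cdot> j = Idn C H"
    using epicD[OF e Comp_Hom[OF w(1) i(2)] Idn_Hom[OF H]] by simp
  then have "monic C j" using split_monic[OF i(2) w(1)] by simp
  then have "monic C h" using monic_comp[OF i(3,4) _ i(2)] i(5) by simp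
  then show ?thesis using that h by blast
qed

lemma kernel_nonzero:
  assumes f: "f \<in> Hom C X Y" "\<not> monic C f" and k: "is_kernel C f k" "k \<in> Hom C K X"
  shows "nonzero_obj C K"
proof (rule ccontr)
  assume nz: "\<not> nonzero_obj C K"
  have "monic C f"
    using f(1)
  proof (rule monic_zeroI)
    fix W g assume g: "g \<in> Hom C W X" "f \<cdot> g = Zer C W Y"
    obtain u where u: "u \<in> Hom C W K" "k \<cdot> u = g"
      using kernel_factor[OF k(1) f(1) g] k(2) Hom_Dom by metis
    then have "u = Zer C W K" using nonzero_objI nz by blast
    then show "g = Zer C W X" using u Comp_Zer[OF k(2)] Hom_Obj[OF g(1)] by simp
  qed
  then show False using f by simp
qed

section \<open>Monoform objects, their uniformity and their atoms\<close>

lemma common_subobj_iff: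
  "(\<exists>a b. subobj C H a \<and> subobj C H' b \<and> nonzero_obj C (Dom C a) \<and> nonzero_obj C (Dom C b) \<and>
      isomorphic C (Dom C a) (Dom C b))
   \<longleftrightarrow> (\<exists>X. nonzero_obj C X \<and> embeds C X H \<and> embeds C X H')" (is "?l \<longleftrightarrow> ?r")
proof
  assume ?l
  then obtain a b f where ab: "subobj C H a" "nonzero_obj C (Dom C a)" "subobj C H' b"
    "f \<in> Hom C (Dom C a) (Dom C b)" "iso_arr C f" by (auto simp: isomorphic_def)
  then have "embeds C (Dom C a) H" "embeds C (Dom C a) (Dom C b)" "embeds C (Dom C b) H'"
    using monic_Hom iso_monic by (fastforce simp: embeds_def subobj_def)+
  then show ?r using embeds_trans ab(2) by blast
next
  assume ?r
  then obtain X a b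
    where X: "nonzero_obj C X" "a \<in> Hom C X H" "monic C a" "b \<in> Hom C X H'" "monic C b"
    by (auto simp: embeds_def)
  then have "X \<in> Obj C" by (simp add: nonzero_obj_def)
  then have "isomorphic C X X"
    unfolding isomorphic_def using Idn_Hom iso_arrI[OF Idn_Hom Idn_Hom] Idn_Comp by metis
  then show ?l using X by (fastforce simp: subobj_def Hom_def)
qed

lemma isomorphic_nonzero:
  assumes "isomorphic C X Y" "nonzero_obj C X"
  shows "nonzero_obj C Y"
proof -
  obtain f where f: "f \<in> Hom C X Y" "iso_arr C f" using assms by (auto simp: isomorphic_def)
  then show ?thesis using monic_nonzero[OF iso_monic] assms nonzero_objI by blast
qed

lemma monoform_iff:
  "monoform C H \<longleftrightarrow> nonzero_obj C H \<and>
     (\<forall>K n q X. monic C n \<and> n \<in> Hom C K H \<and> nonzero_obj C K \<and> is_cokernel C n q \<and>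
        nonzero_obj C X \<and> embeds C X H \<longrightarrow> \<not> embeds C X (Cod C q))"
proof -
  have "(\<exists>a b. subobj C H a \<and> nonzero_obj C (Dom C a) \<and> subobj C R b \<and> isomorphic C (Dom C a) (Dom C b))
      \<longleftrightarrow> (\<exists>X. nonzero_obj C X \<and> embeds C X H \<and> embeds C X R)" for R
    using common_subobj_iff[of H R] isomorphic_nonzero by blast
  then show ?thesis unfolding monoform_def subobj_def by (force simp: Hom_def monic_def)
qed

lemma monoform_nonzero: "monoform C H \<Longrightarrow> nonzero_obj C H"
  by (simp add: monoform_iff)

text \<open>The object found is the intersection of \<open>X\<close> and \<open>Y\<close>: since
  \<open>X\<close> does not embed into \<open>H/Y\<close>, the map from \<open>X\<close> to
  \<open>H/Y\<close> has a nonzero kernel, and that kernel also lies in \<open>Y\<close>.\<close>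

lemma monoform_uniform:
  assumes H: "monoform C H" and X: "nonzero_obj C X" "embeds C X H"
    and Y: "nonzero_obj C Y" "embeds C Y H"
  obtains Z where "nonzero_obj C Z" "embeds C Z X" "embeds C Z Y"
proof -
  obtain x where x: "x \<in> Hom C X H" "monic C x" using X by (auto simp: embeds_def)
  obtain y where y: "y \<in> Hom C Y H" "monic C y" using Y by (auto simp: embeds_def)
  obtain Q q where q: "is_cokernel C y q" "q \<in> Hom C H Q"
    using cokernel_exists[OF y(1)] by metis
  have qx: "q \<cdot> x \<in> Hom C X Q" using Comp_Hom[OF q(2) x(1)] .
  have "\<not> embeds C X (Cod C q)" using H X Y y q unfolding monoform_iff by blast
  then have nm: "\<not> monic C (q \<cdot> x)" using qx Hom_Cod[OF q(2)] by (auto simp: embeds_def)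
  obtain Z z
    where z: "is_kernel C (q \<cdot> x) z" "z \<in> Hom C Z X" "monic C z" "q \<cdot> x \<cdot> z = Zer C Z Q"
    using kernel_exists[OF qx] .
  have xz: "x \<cdot> z \<in> Hom C Z H" "monic C (x \<cdot> z)"
    using Comp_Hom[OF x(1) z(2)] monic_comp[OF x(2,1) z(3,2)] .
  have "q \<cdot> (x \<cdot> z) = Zer C Z Q" using Comp_assoc[OF q(2) x(1) z(2)] z(4) by simp
  then obtain u where u: "u \<in> Hom C Z Y" "y \<cdot> u = x \<cdot> z"
    using kernel_factor[OF monic_is_kernel[OF y(2,1) q(1)] q(2) xz(1)] y(1) Hom_Dom by metis
  have "monic C u" using monic_right[OF _ y(1) u(1)] u(2) xz by simp
  then have "embeds C Z X" "embeds C Z Y" using z u by (auto simp: embeds_def)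
  then show ?thesis using that kernel_nonzero[OF qx nm z(1,2)] by blast
qed

text \<open>For \<open>N\<close> inside \<open>K\<close> the quotient \<open>K/N\<close> embeds into
  \<open>H/N\<close>, so a nonzero common subobject of \<open>K\<close> and \<open>K/N\<close> would
  contradict that \<open>H\<close> is monoform.\<close>

lemma monoform_sub:
  assumes H: "monoform C H" and K: "nonzero_obj C K" "embeds C K H"
  shows "monoform C K"
  unfolding monoform_iff
proof (intro conjI allI impI notI)
  show "nonzero_obj C K" by fact
  fix N n q X
  assume n: "monic C n \<and> n \<in> Hom C N K \<and> nonzero_obj C N \<and> is_cokernel C n q \<and>
    nonzero_obj C X \<and> embeds C X K" and X: "embeds C X (Cod C q)"
  obtain l where l: "l \<in> Hom C K H" "monic C l" using K by (auto simp: embeds_def)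
  have nH: "n \<in> Hom C N K" "monic C n" and q: "is_cokernel C n q" using n by auto
  have qH: "q \<in> Hom C K (Cod C q)" "epic C q" "q \<cdot> n = Zer C N (Cod C q)"
    using cokernelD[OF q nH(1)] by auto
  have ln: "l \<cdot> n \<in> Hom C N H" "monic C (l \<cdot> n)"
    using Comp_Hom[OF l(1) nH(1)] monic_comp[OF l(2,1) nH(2,1)] .
  obtain P p where p: "is_cokernel C (l \<cdot> n) p" "p \<in> Hom C H P"
    using cokernel_exists[OF ln(1)] by metis
  obtain h where "monic C h" "h \<in> Hom C (Cod C q) P"
    using pushout_monic[OF l(2,1) qH(2,1) monic_is_kernel[OF nH(2,1) q] nH(1) p] by metis
  then have "embeds C X (Cod C p)" using X p(2) embeds_trans Hom_Cod by (metis embeds_def)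
  moreover have "embeds C X H" using n K embeds_trans by blast
  ultimately show False using H n ln p(1) unfolding monoform_iff by blast
qed

lemma atom_equiv_iff:
  "(H, H') \<in> atom_equiv C \<longleftrightarrow> monoform C H \<and> monoform C H' \<and>
     (\<exists>X. nonzero_obj C X \<and> embeds C X H \<and> embeds C X H')"
  unfolding atom_equiv_def mem_Collect_eq case_prod_conv common_subobj_iff ..

lemma atom_monoform: "\<lbrakk>\<alpha> \<in> ASpec C; H \<in> \<alpha>\<rbrakk> \<Longrightarrow> monoform C H"
  by (auto simp: ASpec_def quotient_def atom_equiv_iff)

lemma atom_class:
  assumes "monoform C H"
  shows "atom_equiv C `` {H} \<in> ASpec C" "H \<in> atom_equiv C `` {H}"
proof -
  show "atom_equiv C `` {H} \<in> ASpec C" using assms by (auto simp: ASpec_def quotient_def)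
  have "H \<in> Obj C" using monoform_nonzero assms by (auto simp: nonzero_obj_def)
  then show "H \<in> atom_equiv C `` {H}"
    using assms monoform_nonzero embeds_refl by (auto simp: atom_equiv_iff)
qed

text \<open>Uniformity makes \<open>K\<close> meet the subobject that \<open>H\<close> shares with a
  chosen representative. Atoms thus survive shrinking their representatives, on which the support
  arguments rest.\<close>

lemma atom_sub:
  assumes "\<alpha> \<in> ASpec C" "H \<in> \<alpha>" "nonzero_obj C K" "embeds C K H"
  shows "K \<in> \<alpha>"
proof -
  obtain H0 where H0: "\<alpha> = atom_equiv C `` {H0}"
    using assms by (auto simp: ASpec_def quotient_def)
  then obtain X
    where X: "monoform C H0" "monoform C H" "nonzero_obj C X" "embeds C X H0" "embeds C X H"
    using assms(2) by (auto simp: atom_equiv_iff)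
  obtain Z where "nonzero_obj C Z" "embeds C Z X" "embeds C Z K"
    using monoform_uniform[OF X(2,3,5) assms(3,4)] .
  then have "(H0, K) \<in> atom_equiv C"
    using X monoform_sub[OF X(2) assms(3,4)] embeds_trans unfolding atom_equiv_iff by blast
  then show ?thesis using H0 by simp
qed

end

section \<open>Subquotients and atom supports\<close>

context abelian_cat
begin

lemma subquotientI:
  "\<lbrakk>monic C n; n \<in> Hom C L M; epic C e; e \<in> Hom C L H\<rbrakk> \<Longrightarrow> subquotient C H M"
  unfolding subquotient_def subobj_def Hom_def by fastforce

lemma subquotientE:
  assumes "subquotient C H M"
  obtains L n e where "monic C n" "n \<in> Hom C L M" "epic C e" "e \<in> Hom C L H"
proof -
  obtain n e where "monic C n" "Cod C n = M" "epic C e" "Dom C e = Dom C n" "Cod C e = H"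
    using assms by (auto simp: subquotient_def subobj_def)
  then show ?thesis using that[of n "Dom C n" e] monic_Hom[of n] epic_Hom[of e] by simp
qed

text \<open>The definition takes a quotient of a subobject. Here a subobject of a quotient is given,
  and its preimage under \<open>p\<close> is the subobject of which it is a quotient.\<close>

lemma subquotientI':
  assumes "epic C p" "p \<in> Hom C M P" "monic C h" "h \<in> Hom C H P"
  shows "subquotient C H M"
  using pullback_epic[OF assms(3,4,1,2)] subquotientI by metis

text \<open>If \<open>H\<close> is \<open>L/K\<close> with \<open>L\<close> inside \<open>M\<close>,
  then \<open>P\<close> is \<open>M/K\<close>. In this form \<open>H\<close> sits inside a quotient
  of \<open>M\<close>, where further quotients can be taken.\<close>

lemma subquotientE':
  assumes "subquotient C H M"
  obtains P p h where "epic C p" "p \<in> Hom C M P" "monic C h" "h \<in> Hom C H P"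
proof -
  obtain L n e where n: "monic C n" "n \<in> Hom C L M" and e: "epic C e" "e \<in> Hom C L H"
    using subquotientE[OF assms] .
  obtain K k where k: "is_kernel C e k" "k \<in> Hom C K L" using kernel_exists[OF e(2)] .
  obtain P p where p: "is_cokernel C (n \<cdot> k) p" "p \<in> Hom C M P" "epic C p"
    using cokernel_exists[OF Comp_Hom[OF n(2) k(2)]] .
  show ?thesis using pushout_monic[OF n e k p(1,2)] that p by metis
qed

lemma subquotient_epic:
  assumes "subquotient C H Q" "epic C e" "e \<in> Hom C M Q"
  shows "subquotient C H M"
proof -
  obtain P p h where p: "epic C p" "p \<in> Hom C Q P" and h: "monic C h" "h \<in> Hom C H P"
    using subquotientE'[OF assms(1)] .
  show ?thesis using subquotientI'[OF epic_comp[OF p assms(2,3)] Comp_Hom[OF p(2) assms(3)] h] .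
qed

lemma ASupp_epic: "\<lbrakk>epic C e; e \<in> Hom C M Q\<rbrakk> \<Longrightarrow> ASupp C Q \<subseteq> ASupp C M"
  unfolding ASupp_def using subquotient_epic by blast

text \<open>The case distinctions on subquotients only reach a nonzero piece \<open>K\<close> of a
  representative; by \<open>atom_sub\<close> this piece is itself a representative.\<close>

lemma ASupp_subquotient:
  assumes "\<alpha> \<in> ASpec C" "H \<in> \<alpha>" "nonzero_obj C K" "embeds C K H" "subquotient C K M"
  shows "\<alpha> \<in> ASupp C M"
  using atom_sub[OF assms(1-4)] assms unfolding ASupp_def by blast

text \<open>The kernel of \<open>q \<cdot> h\<close> is the intersection of \<open>H\<close> with
  the image of \<open>p\<close>. If \<open>H\<close> does not embed into the cokernel, this
  intersection is nonzero, and it is a subobject of a quotient of \<open>N\<close>.\<close>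

lemma cokernel_monic_or_subquotient:
  assumes h: "monic C h" "h \<in> Hom C H P" and p: "p \<in> Hom C N P"
    and q: "is_cokernel C p q" and nm: "\<not> monic C (q \<cdot> h)"
  obtains K where "nonzero_obj C K" "embeds C K H" "subquotient C K N"
proof -
  have qH: "q \<in> Hom C P (Cod C q)" and epq: "epic C q" and qp: "q \<cdot> p = Zer C N (Cod C q)"
    using cokernelD[OF q p] by auto
  obtain I e m where e: "epic C e" "e \<in> Hom C N I" and m: "monic C m" "m \<in> Hom C I P"
    and pme: "p = m \<cdot> e" using image_exists[OF p] .
  have "q \<cdot> m \<cdot> e = Zer C N (Cod C q)" using Comp_assoc[OF qH m(2) e(2)] pme qp by simp
  then have qm: "q \<cdot> m = Zer C I (Cod C q)"
    using epic_zeroD[OF e Comp_Hom[OF qH m(2)]] by simp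
  \<comment> \<open>Since \<open>e\<close> is epic, \<open>p\<close> and its image \<open>m\<close>
    have the same cokernel, and \<open>m\<close>, being monic, is the kernel of it.\<close>
  have "is_cokernel C m q"
  proof (rule cokernelI[OF epq qH m(2) qm])
    fix W g assume g: "g \<in> Hom C P W" "g \<cdot> m = Zer C I W"
    have "g \<cdot> p = Zer C N W"
      using Comp_assoc[OF g(1) m(2) e(2)] pme g(2) Zer_Comp[OF e(2)] Hom_Obj[OF g(1)] by simp
    then show "\<exists>u \<in> Hom C (Cod C q) W. u \<cdot> q = g"
      using cokernel_factor[OF q p g(1)] by metis
  qed
  then have ker: "is_kernel C q m" using monic_is_kernel[OF m] by blast
  have qh: "q \<cdot> h \<in> Hom C H (Cod C q)" using Comp_Hom[OF qH h(2)] .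
  obtain K k where k: "is_kernel C (q \<cdot> h) k" "k \<in> Hom C K H" "monic C k"
    "q \<cdot> h \<cdot> k = Zer C K (Cod C q)" using kernel_exists[OF qh] .
  have hk: "h \<cdot> k \<in> Hom C K P" "monic C (h \<cdot> k)"
    using Comp_Hom[OF h(2) k(2)] monic_comp[OF h k(3,2)] .
  have "q \<cdot> (h \<cdot> k) = Zer C K (Cod C q)" using Comp_assoc[OF qH h(2) k(2)] k(4) by simp
  then obtain u where u: "u \<in> Hom C K I" "m \<cdot> u = h \<cdot> k"
    using kernel_factor[OF ker qH hk(1)] m(2) Hom_Dom by metis
  have "monic C u" using monic_right[OF _ m(2) u(1)] u(2) hk by simp
  then have "subquotient C K N" using subquotientI'[OF e _ u(1)] by blast
  moreover have "embeds C K H" using k by (auto simp: embeds_def)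
  ultimately show ?thesis using that kernel_nonzero[OF qh nm k(1,2)] by blast
qed

text \<open>The sum is the image of the biproduct in \<open>M\<close>. A quotient of this image,
  taken modulo the contribution of \<open>N1\<close>, is a quotient of \<open>N2\<close>; so every
  atom in the support is seen by one of the two.\<close>

lemma subobj_sum:
  assumes n1: "n1 \<in> Hom C N1 M" and n2: "n2 \<in> Hom C N2 M"
    and U: "ASupp C N1 \<subseteq> U" "ASupp C N2 \<subseteq> U"
  obtains n I u1 u2 where "monic C n" "n \<in> Hom C I M" "ASupp C I \<subseteq> U"
    "u1 \<in> Hom C N1 I" "n \<cdot> u1 = n1" "u2 \<in> Hom C N2 I" "n \<cdot> u2 = n2"
proof -
  have N: "N1 \<in> Obj C" "N2 \<in> Obj C" using Hom_Obj n1 n2 by blast+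
  obtain S i j p q where i: "i \<in> Hom C N1 S" and j: "j \<in> Hom C N2 S"
    and p: "p \<in> Hom C S N1" and q: "q \<in> Hom C S N2"
    and eqs: "p \<cdot> i = Idn C N1" "q \<cdot> j = Idn C N2" "p \<cdot> j = Zer C N2 N1" "q \<cdot> i = Zer C N1 N2"
      "i \<cdot> p \<boxplus> j \<cdot> q = Idn C S"
    using ex_biproduct[OF N] by blast
  \<comment> \<open>The two injections of a biproduct are jointly epic, by the decomposition of the
    identity of \<open>S\<close>.\<close>
  have ij_epic: "g = Zer C S W" if g: "g \<in> Hom C S W" "g \<cdot> i = Zer C N1 W" "g \<cdot> j = Zer C N2 W" for g W
  proof -
    have W: "W \<in> Obj C" and S: "S \<in> Obj C" using Hom_Obj[OF g(1)] by auto
    have "g = g \<cdot> (i \<cdot> p \<boxplus> j \<cdot> q)" using eqs Comp_Idn[OF g(1)] by simp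
    also have "\<dots> = g \<cdot> (i \<cdot> p) \<boxplus> g \<cdot> (j \<cdot> q)"
      using Comp_Add[OF g(1) Comp_Hom[OF i p] Comp_Hom[OF j q]] .
    also have "\<dots> = Zer C S W \<boxplus> Zer C S W"
      using Comp_assoc[OF g(1) i p] Comp_assoc[OF g(1) j q] g Zer_Comp[OF p W] Zer_Comp[OF q W]
        by simp
    finally show ?thesis using Zer_Add[OF Zer_Hom[OF S W]] by simp
  qed
  define f where "f = n1 \<cdot> p \<boxplus> n2 \<cdot> q"
  have np: "n1 \<cdot> p \<in> Hom C S M" and nq: "n2 \<cdot> q \<in> Hom C S M"
    using Comp_Hom n1 n2 p q by blast+
  have f: "f \<in> Hom C S M" unfolding f_def using Add_Hom[OF np nq] .
  have fi: "f \<cdot> i = n1"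
  proof -
    have "f \<cdot> i = n1 \<cdot> p \<cdot> i \<boxplus> n2 \<cdot> q \<cdot> i"
      unfolding f_def using Add_Comp[OF np nq i] .
    also have "\<dots> = n1 \<boxplus> Zer C N1 M"
      using Comp_assoc[OF n1 p i] Comp_assoc[OF n2 q i] eqs Comp_Idn[OF n1] Comp_Zer[OF n2 N(1)]
        by simp
    finally show ?thesis using Add_Zer[OF n1] by simp
  qed
  have fj: "f \<cdot> j = n2"
  proof -
    have "f \<cdot> j = n1 \<cdot> p \<cdot> j \<boxplus> n2 \<cdot> q \<cdot> j"
      unfolding f_def using Add_Comp[OF np nq j] .
    also have "\<dots> = Zer C N2 M \<boxplus> n2"
      using Comp_assoc[OF n1 p j] Comp_assoc[OF n2 q j] eqs Comp_Idn[OF n2] Comp_Zer[OF n1 N(2)]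
        by simp
    finally show ?thesis using Zer_Add[OF n2] by simp
  qed
  obtain I e m where e: "epic C e" "e \<in> Hom C S I" and m: "monic C m" "m \<in> Hom C I M"
    and fme: "f = m \<cdot> e" using image_exists[OF f] .
  have ei: "e \<cdot> i \<in> Hom C N1 I" and ej: "e \<cdot> j \<in> Hom C N2 I"
    using Comp_Hom e i j by blast+
  have "ASupp C I \<subseteq> U"
  proof
    fix \<alpha> assume "\<alpha> \<in> ASupp C I"
    then obtain H where \<alpha>: "\<alpha> \<in> ASpec C"
      and H: "H \<in> \<alpha>" "subquotient C H I"
      by (auto simp: ASupp_def)
    have Hnz: "nonzero_obj C H" using atom_monoform[OF \<alpha> H(1)] monoform_nonzero by blast
    obtain P r h where r: "epic C r" "r \<in> Hom C I P" and h: "monic C h" "h \<in> Hom C H P"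
      using subquotientE'[OF H(2)] .
    have p1: "r \<cdot> (e \<cdot> i) \<in> Hom C N1 P" using Comp_Hom[OF r(2) ei] .
    obtain Q c where c: "is_cokernel C (r \<cdot> (e \<cdot> i)) c" "c \<in> Hom C P Q" "epic C c"
      "c \<cdot> (r \<cdot> (e \<cdot> i)) = Zer C N1 Q" using cokernel_exists[OF p1] .
    have cr: "c \<cdot> r \<in> Hom C I Q" "epic C (c \<cdot> r)"
      using Comp_Hom[OF c(2) r(2)] epic_comp[OF c(3,2) r] .
    have cre: "c \<cdot> r \<cdot> e \<in> Hom C S Q" "epic C (c \<cdot> r \<cdot> e)"
      using Comp_Hom[OF cr(1) e(2)] epic_comp[OF cr(2,1) e] .
    have crei: "c \<cdot> r \<cdot> e \<cdot> i = Zer C N1 Q"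
      using Comp_assoc[OF cr(1) e(2) i] Comp_assoc[OF c(2) r(2) ei] c(4) by simp
    show "\<alpha> \<in> U"
    \<comment> \<open>Either \<open>H\<close> meets the image of \<open>N1\<close> in
      \<open>P\<close>, or it embeds into the quotient \<open>Q\<close> by that image.\<close>
    proof (cases "monic C (c \<cdot> h)")
      case False
      then show ?thesis
        using cokernel_monic_or_subquotient[OF h p1 c(1)] ASupp_subquotient[OF \<alpha> H(1)] U(1)
          by blast
    next
      case True
      have crej: "c \<cdot> r \<cdot> e \<cdot> j \<in> Hom C N2 Q" using Comp_Hom[OF cre(1) j] .
      \<comment> \<open>\<open>c \<cdot> r \<cdot> e\<close> is epic and vanishes on the first
        summand, so its restriction to the second is still epic and \<open>Q\<close> is a quotient
        of \<open>N2\<close>.\<close>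
      have "epic C (c \<cdot> r \<cdot> e \<cdot> j)"
        using crej
      proof (rule epic_zeroI)
        fix W g assume g: "g \<in> Hom C Q W" "g \<cdot> (c \<cdot> r \<cdot> e \<cdot> j) = Zer C N2 W"
        have W: "W \<in> Obj C" using Hom_Obj[OF g(1)] by blast
        have gc: "g \<cdot> (c \<cdot> r \<cdot> e) \<in> Hom C S W"
          using Comp_Hom[OF g(1) cre(1)] .
        have "g \<cdot> (c \<cdot> r \<cdot> e) \<cdot> j = Zer C N2 W"
          using Comp_assoc[OF g(1) cre(1) j] g(2) by simp
        moreover have "g \<cdot> (c \<cdot> r \<cdot> e) \<cdot> i = Zer C N1 W"
          using Comp_assoc[OF g(1) cre(1) i] crei Comp_Zer[OF g(1) N(1)] by simp
        ultimately have "g \<cdot> (c \<cdot> r \<cdot> e) = Zer C S W"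
          using ij_epic[OF gc] by blast
        then show "g = Zer C Q W" using epic_zeroD[OF cre(2,1) g(1)] by blast
      qed
      then have "subquotient C H N2"
        using subquotientI'[OF _ crej True Comp_Hom[OF c(2) h(2)]] by blast
      then show ?thesis using \<alpha> H U(2) by (auto simp: ASupp_def)
    qed
  qed
  moreover have "m \<cdot> (e \<cdot> i) = n1" "m \<cdot> (e \<cdot> j) = n2"
    using Comp_assoc[OF m(2) e(2) i] Comp_assoc[OF m(2) e(2) j] fme fi fj by auto
  ultimately show ?thesis using that m ei ej by blast
qed

text \<open>All objects are quotients of the same \<open>P\<close>, so the transition maps are
  determined by compatibility with the epimorphisms \<open>q i\<close>, and cancelling these gives
  the laws of a direct system.\<close>

lemma quotient_direct_system:
  assumes I: "directed I r" "r \<subseteq> I \<times> I"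
    and q: "\<And>i. i \<in> I \<Longrightarrow> epic C (q i) \<and> q i \<in> Hom C P (Cod C (q i))"
    and ex: "\<And>i j. (i, j) \<in> r \<Longrightarrow> \<exists>f \<in> Hom C (Cod C (q i)) (Cod C (q j)). f \<cdot> q i = q j"
  obtains t where "direct_system C I r (\<lambda>i. Cod C (q i)) t"
    "\<And>i j. (i, j) \<in> r \<Longrightarrow> t i j \<in> Hom C (Cod C (q i)) (Cod C (q j))"
    "\<And>i j. (i, j) \<in> r \<Longrightarrow> t i j \<cdot> q i = q j"
proof -
  obtain t
    where t: "\<And>i j. (i, j) \<in> r \<Longrightarrow> t i j \<in> Hom C (Cod C (q i)) (Cod C (q j)) \<and> t i j \<cdot> q i = q j"
    using ex by metis
  have refl: "(i, i) \<in> r" if "i \<in> I" for i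
    using that I by (auto simp: directed_def preorder_on_def refl_on_def)
  have tr: "(i, k) \<in> r" if "(i, j) \<in> r" "(j, k) \<in> r" for i j k
    using that I by (auto simp: directed_def preorder_on_def dest: transD)
  have Q: "Cod C (q i) \<in> Obj C" if "i \<in> I" for i using q[OF that] Hom_Obj by blast
  have "t i i = Idn C (Cod C (q i))" if "i \<in> I" for i
    using epicD[of "q i" P "Cod C (q i)" "t i i" "Cod C (q i)" "Idn C (Cod C (q i))"] t[OF refl[OF that]] q[OF that]
      Idn_Hom[OF Q[OF that]] Idn_Comp[of "q i" P] by simp
  moreover have "t j k \<cdot> t i j = t i k" if r: "(i, j) \<in> r" "(j, k) \<in> r" for i j k
  proof -
    have i: "i \<in> I" using r I by blast
    have "t j k \<cdot> t i j \<cdot> q i = t i k \<cdot> q i"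
      using
        Comp_assoc[of "t j k" "Cod C (q j)" "Cod C (q k)" "t i j" "Cod C (q i)" "q i" P] t[OF r(1)] t[OF r(2)] t[OF tr[OF r]] q[OF i] by simp
    then show ?thesis
      using epicD[of "q i"] q[OF i] t[OF tr[OF r]] Comp_Hom[of "t j k"] t[OF r(1)] t[OF r(2)]
        by blast
  qed
  ultimately have "direct_system C I r (\<lambda>i. Cod C (q i)) t"
    unfolding direct_system_def using I(1) t Q by blast
  then show ?thesis using that t by blast
qed

end

section \<open>Existence of the section functor\<close>

lemma small_subset: "\<lbrakk>small \<kappa> B; A \<subseteq> B\<rbrakk> \<Longrightarrow> small \<kappa> A"
  unfolding small_def using card_of_mono1 ordLeq_ordLess_trans by blast

lemma small_image: "small \<kappa> A \<Longrightarrow> small \<kappa> (f ` A)"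
  unfolding small_def using card_of_image ordLeq_ordLess_trans by blast

text \<open>Coproducts and direct limits are provided for index sets in the carrier type of
  \<open>\<kappa>\<close>; this injection moves small families there.\<close>

lemma small_embedding:
  fixes \<kappa> :: "'k rel"
  assumes "Card_order \<kappa>" "small \<kappa> A"
  obtains f :: "'b \<Rightarrow> 'k" where "inj_on f A"
proof -
  have "|A| \<le>o |Field \<kappa>|"
    using assms card_of_Field_ordIso[OF assms(1)] ordIso_symmetric ordLess_imp_ordLeq ordLeq_ordIso_trans
    unfolding small_def by blast
  then show ?thesis using card_of_ordLeq[of A "Field \<kappa>"] that by blast
qed

text \<open>Closure of the universe under powersets is assumed for subsets of the carrier type, so
  the powerset is formed on the image of an injection and pulled back.\<close>

lemma small_Pow:
  fixes \<kappa> :: "'k rel" and A :: "'b set"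
  assumes "universe_cardinal \<kappa>" "small \<kappa> A"
  shows "small \<kappa> (Pow A)"
proof -
  have "Card_order \<kappa>" using assms by (simp add: universe_cardinal_def cinfinite_def)
  then obtain f :: "'b \<Rightarrow> 'k" where f: "inj_on f A"
    using small_embedding assms(2) by blast
  have "small \<kappa> (Pow (f ` A))" using assms small_image by (auto simp: universe_cardinal_def)
  then have "small \<kappa> ((\<lambda>B. inv_into A f ` B) ` Pow (f ` A))" by (rule small_image)
  moreover have "B \<in> (\<lambda>B. inv_into A f ` B) ` Pow (f ` A)" if "B \<subseteq> A" for B
    using inv_into_image_cancel[OF f that] image_mono[OF that, of f]
      by (intro image_eqI[of _ _ "f ` B"]) auto
  ultimately show ?thesis by (auto elim!: small_subset)
qed

context grothendieck_cat
begin

text \<open>A subobject is determined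
  by the set of morphisms from a generator that factor through it.\<close>

lemma subobj_representatives:
  assumes M: "M \<in> Obj C" and S: "\<And>m. m \<in> \<S> \<Longrightarrow> subobj C M m"
  obtains I :: "'k set" and n
    where "small \<kappa> I" "\<And>i. i \<in> I \<Longrightarrow> n i \<in> \<S>"
    "\<And>m. m \<in> \<S> \<Longrightarrow> \<exists>i \<in> I. sub_le C m (n i)"
proof -
  obtain G where G: "is_generator C {G}" using ex_generator by blast
  then have GO: "G \<in> Obj C" by (simp add: is_generator_def)
  define F where "F m = (\<lambda>u. m \<cdot> u) ` Hom C G (Dom C m)" for m
  have le: "sub_le C m n" if m: "m \<in> \<S>" and n: "n \<in> \<S>"
    and mn: "F m \<subseteq> F n" for m n
  proof -
    have mH: "m \<in> Hom C (Dom C m) M" and nH: "n \<in> Hom C (Dom C n) M" "monic C n"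
      using S[OF m] S[OF n] by (auto simp: subobj_def dest: monic_Hom)
    obtain Q q
      where q: "is_cokernel C n q" "q \<in> Hom C M Q" "epic C q" "q \<cdot> n = Zer C (Dom C n) Q"
      using cokernel_exists[OF nH(1)] .
    have Q: "Q \<in> Obj C" and mD: "Dom C m \<in> Obj C"
      using Hom_Obj[OF q(2)] Hom_Obj[OF mH] by auto
    \<comment> \<open>The generator detects zero morphisms, and for every \<open>h\<close> from
      \<open>G\<close> the composite \<open>q \<cdot> m \<cdot> h\<close> has the form
      \<open>q \<cdot> n \<cdot> u\<close>, which is zero.\<close>
    have "q \<cdot> m = Zer C (Dom C m) Q"
    proof -
      have "q \<cdot> m \<cdot> h = Zer C (Dom C m) Q \<cdot> h" if h: "h \<in> Hom C G (Dom C m)" for h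
      proof -
        have "m \<cdot> h \<in> F n" using mn h unfolding F_def by blast
        then obtain u where u: "u \<in> Hom C G (Dom C n)" "m \<cdot> h = n \<cdot> u"
          unfolding F_def by auto
        have "q \<cdot> m \<cdot> h = q \<cdot> n \<cdot> u"
          using Comp_assoc[OF q(2) mH h] Comp_assoc[OF q(2) nH(1) u(1)] u(2) by simp
        then show ?thesis using q(4) Zer_Comp[OF u(1) Q] Zer_Comp[OF h Q] by simp
      qed
      then show ?thesis
        using G Comp_Hom[OF q(2) mH] Zer_Hom[OF mD Q] unfolding is_generator_def by blast
    qed
    then show ?thesis
      using kernel_factor[OF monic_is_kernel[OF nH(2,1) q(1)] q(2) mH] unfolding sub_le_def by metis
  qed
  have "F ` \<S> \<subseteq> Pow (Hom C G M)"
  proof clarify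
    fix m h assume "m \<in> \<S>" "h \<in> F m"
    then obtain u where u: "u \<in> Hom C G (Dom C m)" "h = m \<cdot> u" by (auto simp: F_def)
    have mH: "m \<in> Hom C (Dom C m) M"
      using S[OF \<open>m \<in> \<S>\<close>] monic_Hom[of m] by (auto simp: subobj_def)
    show "h \<in> Hom C G M" unfolding u(2) by (rule Comp_Hom[OF mH u(1)])
  qed
  then have small: "small \<kappa> (F ` \<S>)"
    using small_subset small_Pow[OF universe locally_small[OF GO M]] by blast
  have "Card_order \<kappa>" using universe by (simp add: universe_cardinal_def cinfinite_def)
  then obtain \<phi> :: "'a set \<Rightarrow> 'k" where \<phi>: "inj_on \<phi> (F ` \<S>)"
    using small_embedding small by blast
  \<comment> \<open>The index set consists of codes for the sets \<open>F m\<close>, and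
    \<open>n\<close> picks one subobject for each code. Subobjects with the same code are contained
    in each other.\<close>
  define n where "n i = (SOME m. m \<in> \<S> \<and> \<phi> (F m) = i)" for i
  have n: "n i \<in> \<S> \<and> \<phi> (F (n i)) = i" if i: "i \<in> \<phi> ` F ` \<S>" for i
    unfolding n_def by (rule someI_ex) (use i in auto)
  show ?thesis
  proof (rule that[of "\<phi> ` F ` \<S>" n])
    show "small \<kappa> (\<phi> ` F ` \<S>)" using small by (rule small_image)
    show "n i \<in> \<S>" if "i \<in> \<phi> ` F ` \<S>" for i using n[OF that] by simp
    show "\<exists>i \<in> \<phi> ` F ` \<S>. sub_le C m (n i)" if m: "m \<in> \<S>" for m
    proof (rule bexI)
      show i: "\<phi> (F m) \<in> \<phi> ` F ` \<S>" using m by blast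
      have "F (n (\<phi> (F m))) = F m" using n[OF i] \<phi> m by (auto dest: inj_onD)
      then show "sub_le C m (n (\<phi> (F m)))" using le[OF m] n[OF i] by simp
    qed
  qed
qed

text \<open>The only use of exactness of direct limits: if \<open>H\<close> met none of the images of the \<open>N i\<close> in
  \<open>P\<close>, it would embed into all the cokernels \<open>P / N i\<close>
    and hence into their direct limit, which
  receives only the zero morphism from \<open>P\<close>.\<close>

lemma directed_cover_subquotient:
  fixes I :: "'k set"
  assumes I: "small \<kappa> I" "I \<noteq> {}"
    and s: "\<And>i. i \<in> I \<Longrightarrow> s i \<in> Hom C (N i) S"
    and dir: "\<And>i j. \<lbrakk>i \<in> I; j \<in> I\<rbrakk> \<Longrightarrow> \<exists>k \<in> I. (\<exists>u \<in> Hom C (N i) (N k). s k \<cdot> u = s i) \<and>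
      (\<exists>u \<in> Hom C (N j) (N k). s k \<cdot> u = s j)"
    and cover: "\<And>W g. \<lbrakk>g \<in> Hom C S W; \<And>i. i \<in> I \<Longrightarrow> g \<cdot> s i = Zer C (N i) W\<rbrakk> \<Longrightarrow> g = Zer C S W"
    and H: "nonzero_obj C H" "subquotient C H S"
  obtains i K where "i \<in> I" "nonzero_obj C K" "embeds C K H" "subquotient C K (N i)"
proof (rule ccontr)
  note witness = that
  assume "\<not> thesis"
  then have none: False if "i \<in> I" "nonzero_obj C K" "embeds C K H" "subquotient C K (N i)" for i K
    using witness[OF that] by blast
  obtain P e h where e: "epic C e" "e \<in> Hom C S P" and h: "monic C h" "h \<in> Hom C H P"
    using subquotientE'[OF H(2)] .
  have HO: "H \<in> Obj C" using H by (simp add: nonzero_obj_def)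
  have es: "e \<cdot> s i \<in> Hom C (N i) P" if "i \<in> I" for i
    using Comp_Hom[OF e(2) s[OF that]] .
  have "\<forall>i. \<exists>q. i \<in> I \<longrightarrow> is_cokernel C (e \<cdot> s i) q"
    using cokernel_exists[OF es] by metis
  then obtain q where cq: "\<And>i. i \<in> I \<Longrightarrow> is_cokernel C (e \<cdot> s i) (q i)"
    by metis
  note q = cokernelD[OF cq es]
  define f where "f i = q i \<cdot> h" for i
  have f: "f i \<in> Hom C H (Cod C (q i))" if "i \<in> I" for i
    unfolding f_def using Comp_Hom[OF q(1)[OF that that] h(2)] .
  have fm: "monic C (f i)" if i: "i \<in> I" for i
    unfolding f_def using cokernel_monic_or_subquotient[OF h es[OF i] cq[OF i]] none[OF i] by metis
  have "\<forall>i. \<exists>z. i \<in> I \<longrightarrow> is_cokernel C (f i) z"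
    using cokernel_exists[OF f] by metis
  then obtain z where cz: "\<And>i. i \<in> I \<Longrightarrow> is_cokernel C (f i) (z i)" by metis
  note z = cokernelD[OF cz f]
  \<comment> \<open>The third term of the exact sequences, the quotient of
    \<open>Cod C (q i)\<close> by \<open>H\<close>, is presented as a quotient of \<open>P\<close>,
    so that its direct system arises in the same way as that of the \<open>q i\<close>.\<close>
  define y where "y i = z i \<cdot> q i" for i
  have codY: "Cod C (y i) = Cod C (z i)" if i: "i \<in> I" for i
    unfolding y_def using Comp_Hom[OF z(1)[OF i i] q(1)[OF i i]] Hom_Cod by blast
  have yH: "y i \<in> Hom C P (Cod C (z i))" "epic C (y i)" if i: "i \<in> I" for i
    unfolding y_def
    using Comp_Hom[OF z(1)[OF i i] q(1)[OF i i]]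
      epic_comp[OF z(3)[OF i i] z(1)[OF i i] q(3)[OF i i] q(1)[OF i i]] by auto
  \<comment> \<open>Indices are compared by factoring over \<open>S\<close>. This is only a
    preorder, as different indices may factor through one another.\<close>
  define r
    where "r = {(i, j) \<in> I \<times> I. \<exists>u \<in> Hom C (N i) (N j). s j \<cdot> u = s i}"
  have r: "r \<subseteq> I \<times> I" by (auto simp: r_def)
  have "directed I r"
    unfolding directed_def preorder_on_def
  proof (intro conjI ballI)
    show "refl_on I r"
    proof (rule refl_onI)
      fix i assume i: "i \<in> I"
      show "(i, i) \<in> r"
        unfolding r_def using i Comp_Idn[OF s[OF i]] Idn_Hom[OF Hom_Obj(1)[OF s[OF i]]] by auto
    qed
    show "trans r"
    proof (rule transI)
      fix i j k assume ij: "(i, j) \<in> r" and jk: "(j, k) \<in> r"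
      then obtain u v
        where uv: "i \<in> I" "j \<in> I" "k \<in> I" "u \<in> Hom C (N i) (N j)" "s j \<cdot> u = s i"
        "v \<in> Hom C (N j) (N k)" "s k \<cdot> v = s j" by (auto simp: r_def)
      have "s k \<cdot> (v \<cdot> u) = s i" using Comp_assoc[OF s[OF uv(3)] uv(6,4)] uv by simp
      then show "(i, k) \<in> r" unfolding r_def using uv Comp_Hom[OF uv(6,4)] by blast
    qed
    fix i j assume ij: "i \<in> I" "j \<in> I"
    show "\<exists>k \<in> I. (i, k) \<in> r \<and> (j, k) \<in> r"
      using dir[OF ij] ij by (auto simp: r_def)
  qed (use I r in auto)
  have exq: "\<exists>g \<in> Hom C (Cod C (q i)) (Cod C (q j)). g \<cdot> q i = q j" if ij: "(i, j) \<in> r" for i j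
  proof -
    obtain u where u: "i \<in> I" "j \<in> I" "u \<in> Hom C (N i) (N j)" "s j \<cdot> u = s i"
      using ij by (auto simp: r_def)
    have "e \<cdot> s i = e \<cdot> s j \<cdot> u"
      using Comp_assoc[OF e(2) s[OF u(2)] u(3)] u(4) by simp
    then have "q j \<cdot> (e \<cdot> s i) = Zer C (N i) (Cod C (q j))"
      using Comp_assoc[OF q(1)[OF u(2,2)] es[OF u(2)] u(3)] q(2)[OF u(2,2)] Zer_Comp[OF u(3)]
        Hom_Obj[OF q(1)[OF u(2,2)]] by simp
    then show ?thesis using cokernel_factor[OF cq[OF u(1)] es[OF u(1)] q(1)[OF u(2,2)]] by metis
  qed
  have exy: "\<exists>g \<in> Hom C (Cod C (y i)) (Cod C (y j)). g \<cdot> y i = y j" if ij: "(i, j) \<in> r" for i j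
  proof -
    have i: "i \<in> I" and j: "j \<in> I" using r ij by auto
    obtain g where g: "g \<in> Hom C (Cod C (q i)) (Cod C (q j))" "g \<cdot> q i = q j"
      using exq[OF ij] by blast
    have zg: "z j \<cdot> g \<in> Hom C (Cod C (q i)) (Cod C (z j))"
      using Comp_Hom[OF z(1)[OF j j] g(1)] .
    have gf: "g \<cdot> f i = f j"
      unfolding f_def using Comp_assoc[OF g(1) q(1)[OF i i] h(2)] g(2) by simp
    have "z j \<cdot> g \<cdot> f i = Zer C H (Cod C (z j))"
      using Comp_assoc[OF z(1)[OF j j] g(1) f[OF i]] gf z(2)[OF j j] by simp
    then obtain v
      where v: "v \<in> Hom C (Cod C (z i)) (Cod C (z j))" "v \<cdot> z i = z j \<cdot> g"
      using cokernel_factor[OF cz[OF i] f[OF i] zg] by blast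
    have "v \<cdot> y i = y j"
      unfolding y_def
      using Comp_assoc[OF v(1) z(1)[OF i i] q(1)[OF i i]]
        Comp_assoc[OF z(1)[OF j j] g(1) q(1)[OF i i]] v g by simp
    then show ?thesis using v codY i j by auto
  qed
  have qq: "\<And>i. i \<in> I \<Longrightarrow> epic C (q i) \<and> q i \<in> Hom C P (Cod C (q i))" using q by blast
  have yy: "\<And>i. i \<in> I \<Longrightarrow> epic C (y i) \<and> y i \<in> Hom C P (Cod C (y i))" using yH codY by auto
  obtain t where t: "direct_system C I r (\<lambda>i. Cod C (q i)) t"
    "\<And>i j. (i, j) \<in> r \<Longrightarrow> t i j \<in> Hom C (Cod C (q i)) (Cod C (q j))"
    "\<And>i j. (i, j) \<in> r \<Longrightarrow> t i j \<cdot> q i = q j"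
    using quotient_direct_system[of I r q P] \<open>directed I r\<close> r qq exq by metis
  obtain w where w: "direct_system C I r (\<lambda>i. Cod C (y i)) w"
    "\<And>i j. (i, j) \<in> r \<Longrightarrow> w i j \<in> Hom C (Cod C (y i)) (Cod C (y j))"
    "\<And>i j. (i, j) \<in> r \<Longrightarrow> w i j \<cdot> y i = y j"
    using quotient_direct_system[of I r y P] \<open>directed I r\<close> r yy exy by metis
  define c where "c = (\<lambda>(i::'k) (j::'k). Idn C H)"
  have sysH: "direct_system C I r (\<lambda>_. H) c"
    unfolding direct_system_def c_def
      using \<open>directed I r\<close> HO Idn_Hom Comp_Idn[OF Idn_Hom[OF HO]] by auto
  have homf: "system_hom C I r (\<lambda>_. H) c (\<lambda>i. Cod C (q i)) t f"
    unfolding system_hom_def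
  proof (intro conjI allI ballI impI)
    fix i j assume ij: "(i, j) \<in> r"
    then have i: "i \<in> I" and j: "j \<in> I" using r by auto
    show "f j \<cdot> c i j = t i j \<cdot> f i"
      using Comp_Idn[OF f[OF j]] Comp_assoc[OF t(2)[OF ij] q(1)[OF i i] h(2)] t(3)[OF ij]
      by (simp add: c_def f_def)
  qed (use f in auto)
  have wz: "w i j \<cdot> z i = z j \<cdot> t i j" if ij: "(i, j) \<in> r" for i j
  proof -
    have i: "i \<in> I" and j: "j \<in> I" using r ij by auto
    have wH: "w i j \<in> Hom C (Cod C (z i)) (Cod C (z j))" using w(2)[OF ij] codY i j by simp
    have "w i j \<cdot> z i \<cdot> q i = z j \<cdot> t i j \<cdot> q i"
      using Comp_assoc[OF wH z(1)[OF i i] q(1)[OF i i]]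
        Comp_assoc[OF z(1)[OF j j] t(2)[OF ij] q(1)[OF i i]]
        w(3)[OF ij] t(3)[OF ij] by (simp add: y_def)
    then show ?thesis
      using epicD[OF q(3)[OF i i] q(1)[OF i i] Comp_Hom[OF wH z(1)[OF i i]] Comp_Hom[OF z(1)[OF j j] t(2)[OF ij]]]
      by simp
  qed
  have homz: "system_hom C I r (\<lambda>i. Cod C (q i)) t (\<lambda>i. Cod C (y i)) w z"
    unfolding system_hom_def using z(1) codY wz by auto
  have exact: "short_exact C (f i) (z i)" if i: "i \<in> I" for i
    unfolding short_exact_def using monic_is_kernel[OF fm[OF i] f[OF i] cz[OF i]] cz[OF i] by simp
  obtain B b where B: "is_direct_limit C I r (\<lambda>i. Cod C (q i)) t B b"
    using ex_direct_limit[OF I(1) t(1)] by blast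
  obtain D d where D: "is_direct_limit C I r (\<lambda>i. Cod C (y i)) w D d"
    using ex_direct_limit[OF I(1) w(1)] by blast
  have bH: "b i \<in> Hom C (Cod C (q i)) B" if "i \<in> I" for i
    using B that by (auto simp: is_direct_limit_def cocone_def)
  have bt: "b j \<cdot> t i j = b i" if "(i, j) \<in> r" for i j
    using B that by (auto simp: is_direct_limit_def cocone_def)
  have dH: "d i \<in> Hom C (Cod C (z i)) D" if "i \<in> I" for i
    using D that codY by (auto simp: is_direct_limit_def cocone_def)
  have dw: "d j \<cdot> w i j = d i" if "(i, j) \<in> r" for i j
    using D that by (auto simp: is_direct_limit_def cocone_def)
  \<comment> \<open>On a directed preorder a function unchanged along related indices is constant.
    This serves the constant system on \<open>H\<close> and the composites
    \<open>b i \<cdot> q i\<close>.\<close>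
  have const: "x i = x j" if i: "i \<in> I" and j: "j \<in> I"
    and x: "\<And>i j. (i, j) \<in> r \<Longrightarrow> x j = x i" for i j
      and x :: "'k \<Rightarrow> 'a"
  proof -
    obtain k where "(i, k) \<in> r" "(j, k) \<in> r"
      using \<open>directed I r\<close> i j by (auto simp: directed_def)
    then show ?thesis using x by metis
  qed
  have limH: "is_direct_limit C I r (\<lambda>_. H) c H (\<lambda>_. Idn C H)"
    unfolding is_direct_limit_def
  proof (intro conjI allI impI)
    show "cocone C I r (\<lambda>_. H) c H (\<lambda>_. Idn C H)"
      unfolding cocone_def c_def using HO Idn_Hom Comp_Idn[OF Idn_Hom[OF HO]] by auto
    fix M g assume g: "cocone C I r (\<lambda>_. H) c M g"
    obtain i where i: "i \<in> I" using I by blast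
    have gH: "g j \<in> Hom C H M" if "j \<in> I" for j using g that by (auto simp: cocone_def)
    have "g j = g k" if "(j, k) \<in> r" for j k
    proof -
      have "k \<in> I" using r that by auto
      moreover have "g k \<cdot> Idn C H = g j" using g that by (auto simp: cocone_def c_def)
      ultimately show ?thesis using Comp_Idn[OF gH] by metis
    qed
    then have gg: "g i = g j" if "j \<in> I" for j using const[OF i that, of g] by metis
    show "\<exists>!u. u \<in> Hom C H M \<and> (\<forall>i \<in> I. u \<cdot> Idn C H = g i)"
    proof (rule ex1I[of _ "g i"])
      show "g i \<in> Hom C H M \<and> (\<forall>j \<in> I. g i \<cdot> Idn C H = g j)"
        using gg gH[OF i] Comp_Idn by auto
      show "u = g i" if "u \<in> Hom C H M \<and> (\<forall>i \<in> I. u \<cdot> Idn C H = g i)" for u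
        using that i Comp_Idn by auto
    qed
  qed
  obtain i0 where i0: "i0 \<in> I" using I by blast
  have bqH: "b i \<cdot> q i \<in> Hom C P B" if "i \<in> I" for i
    using Comp_Hom[OF bH q(1)] that by blast
  have "b j \<cdot> q j = b i \<cdot> q i" if ij: "(i, j) \<in> r" for i j
  proof -
    have i: "i \<in> I" and j: "j \<in> I" using r ij by auto
    show ?thesis
      using Comp_assoc[OF bH[OF j] t(2)[OF ij] q(1)[OF i i]] bt[OF ij] t(3)[OF ij] by simp
  qed
  then have bq: "b i \<cdot> q i = b i0 \<cdot> q i0" if "i \<in> I" for i
    using const[OF that i0, of "\<lambda>i. b i \<cdot> q i"] by blast
  \<comment> \<open>As \<open>b i \<cdot> q i\<close> is the same morphism for all \<open>i\<close>,
    the map induced on limits can be written with the single index \<open>i0\<close>.\<close>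
  define u where "u = b i0 \<cdot> q i0 \<cdot> h"
  have uH: "u \<in> Hom C H B" unfolding u_def using Comp_Hom[OF bqH[OF i0] h(2)] .
  have ub: "u \<cdot> Idn C H = b i \<cdot> f i" if i: "i \<in> I" for i
    using Comp_Idn[OF uH] Comp_assoc[OF bH[OF i] q(1)[OF i i] h(2)] bq[OF i]
      by (simp add: u_def f_def)
  have dz: "cocone C I r (\<lambda>i. Cod C (q i)) t D (\<lambda>i. d i \<cdot> z i)"
    unfolding cocone_def
  proof (intro conjI allI ballI impI)
    show "D \<in> Obj C" using D by (auto simp: is_direct_limit_def cocone_def)
    show "d i \<cdot> z i \<in> Hom C (Cod C (q i)) D" if "i \<in> I" for i
      using Comp_Hom[OF dH z(1)] that by blast
    fix i j assume ij: "(i, j) \<in> r"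
    then have i: "i \<in> I" and j: "j \<in> I" using r by auto
    have wH: "w i j \<in> Hom C (Cod C (z i)) (Cod C (z j))" using w(2)[OF ij] codY i j by simp
    show "d j \<cdot> z j \<cdot> t i j = d i \<cdot> z i"
      using Comp_assoc[OF dH[OF j] z(1)[OF j j] t(2)[OF ij]] Comp_assoc[OF dH[OF j] wH z(1)[OF i i]]
        wz[OF ij] dw[OF ij] by simp
  qed
  have "\<forall>M g. cocone C I r (\<lambda>i. Cod C (q i)) t M g \<longrightarrow>
      (\<exists>!v. v \<in> Hom C B M \<and> (\<forall>i \<in> I. v \<cdot> b i = g i))"
    using B by (simp add: is_direct_limit_def)
  from this[rule_format, OF dz]
  obtain v
    where v: "v \<in> Hom C B D" "\<And>i. i \<in> I \<Longrightarrow> v \<cdot> b i = d i \<cdot> z i" by blast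
  have "short_exact C u v"
    by (rule direct_limit_exact[OF I(1) sysH t(1) w(1) homf homz exact limH B D uH ub v])
  then have um: "monic C u" using kernelD(3)[OF _ v(1)] by (auto simp: short_exact_def)
  \<comment> \<open>Each \<open>q i\<close> kills the image of \<open>N i\<close>, and the
    \<open>N i\<close> jointly cover \<open>S\<close>, so the map from \<open>S\<close> to the limit
    vanishes. Cancelling \<open>e\<close> makes \<open>u\<close> zero, although it is monic and
    \<open>H\<close> is nonzero.\<close>
  have "b i0 \<cdot> q i0 \<cdot> e = Zer C S B"
  proof (rule cover)
    show "b i0 \<cdot> q i0 \<cdot> e \<in> Hom C S B" using Comp_Hom[OF bqH[OF i0] e(2)] .
    fix i assume i: "i \<in> I"
    have "b i0 \<cdot> q i0 \<cdot> e \<cdot> s i = b i \<cdot> (q i \<cdot> (e \<cdot> s i))"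
      using Comp_assoc[OF bqH[OF i0] e(2) s[OF i]] bq[OF i]
        Comp_assoc[OF bH[OF i] q(1)[OF i i] es[OF i]] by simp
    then show "b i0 \<cdot> q i0 \<cdot> e \<cdot> s i = Zer C (N i) B"
      using q(2)[OF i i] Comp_Zer[OF bH[OF i]] Hom_Obj[OF s[OF i]] by simp
  qed
  then have "b i0 \<cdot> q i0 = Zer C P B" using epic_zeroD[OF e bqH[OF i0]] by blast
  then have "u = Zer C H B" unfolding u_def using Zer_Comp[OF h(2)] Hom_Obj[OF uH] by simp
  then show False using monic_nonzero[OF um uH H(1)] by simp
qed

text \<open>The union of the representatives is realised as the image of their coproduct in
  \<open>M\<close>. Two facts about it give the support: the representatives are directed in it and
  jointly epic onto it.\<close>

lemma largest_subobj:
  assumes M: "M \<in> Obj C"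
  obtains n where "subobj C M n" "ASupp C (Dom C n) \<subseteq> U"
    "\<And>m. \<lbrakk>subobj C M m; ASupp C (Dom C m) \<subseteq> U\<rbrakk> \<Longrightarrow> sub_le C m n"
proof -
  let ?S = "{m. subobj C M m \<and> ASupp C (Dom C m) \<subseteq> U}"
  obtain I :: "'k set" and n where I: "small \<kappa> I"
    and nS: "\<And>i. i \<in> I \<Longrightarrow> n i \<in> ?S"
    and rep: "\<And>m. m \<in> ?S \<Longrightarrow> \<exists>i \<in> I. sub_le C m (n i)"
    using subobj_representatives[OF M, of ?S] by blast
  have n: "n i \<in> Hom C (Dom C (n i)) M" "monic C (n i)" "ASupp C (Dom C (n i)) \<subseteq> U" if "i \<in> I" for i
    using nS[OF that] monic_Hom[of "n i"] by (auto simp: subobj_def)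
  \<comment> \<open>The zero subobject has empty support, hence lies in the family; this makes the
    index set nonempty, as directedness demands.\<close>
  obtain Z where Z: "zero_obj C Z" using ex_zero_obj by blast
  then obtain o0 where o0: "o0 \<in> Hom C Z M" using M unfolding zero_obj_def by blast
  have "monic C o0"
  proof (rule monicI[OF o0])
    fix W f g assume fg: "f \<in> Hom C W Z" "g \<in> Hom C W Z"
    then show "f = g" using Z Hom_Obj(1)[OF fg(1)] unfolding zero_obj_def by blast
  qed
  moreover have "ASupp C Z = {}"
  proof -
    have "zero_obj C H" if sub: "subquotient C H Z" for H
    proof -
      obtain P p h where "epic C p" "p \<in> Hom C Z P" "monic C h" "h \<in> Hom C H P"
        using subquotientE'[OF sub] .
      then show ?thesis
        using Z epic_nonzero monic_nonzero nonzero_objI Hom_Obj by (metis nonzero_obj_def)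
    qed
    then show ?thesis
      using atom_monoform monoform_nonzero by (fastforce simp: ASupp_def nonzero_obj_def)
  qed
  ultimately have "o0 \<in> ?S" using o0 by (auto simp: subobj_def Hom_def)
  then have Ine: "I \<noteq> {}" using rep by blast
  have NO: "Dom C (n i) \<in> Obj C" if "i \<in> I" for i using n(1)[OF that] Hom_Obj by blast
  obtain T c where T: "is_coproduct C I (\<lambda>i. Dom C (n i)) T c"
    using ex_coproduct[OF I, of "\<lambda>i. Dom C (n i)"] NO by blast
  have TO: "T \<in> Obj C"
    and cH: "\<And>i. i \<in> I \<Longrightarrow> c i \<in> Hom C (Dom C (n i)) T"
    using T by (auto simp: is_coproduct_def)
  have uniq: "\<exists>!u. u \<in> Hom C T Y \<and> (\<forall>i \<in> I. u \<cdot> c i = f i)"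
    if "Y \<in> Obj C" "\<And>i. i \<in> I \<Longrightarrow> f i \<in> Hom C (Dom C (n i)) Y" for Y f
    using T that unfolding is_coproduct_def by blast
  obtain f where f: "f \<in> Hom C T M" "\<And>i. i \<in> I \<Longrightarrow> f \<cdot> c i = n i"
    using uniq[OF M n(1)] by blast
  obtain S e m where e: "epic C e" "e \<in> Hom C T S" and m: "monic C m" "m \<in> Hom C S M"
    and fme: "f = m \<cdot> e"
    using image_exists[OF f(1)] .
  define s where "s i = e \<cdot> c i" for i
  have s: "s i \<in> Hom C (Dom C (n i)) S" if "i \<in> I" for i
    unfolding s_def using Comp_Hom[OF e(2) cH[OF that]] .
  have ms: "m \<cdot> s i = n i" if "i \<in> I" for i
    unfolding s_def using Comp_assoc[OF m(2) e(2) cH[OF that]] fme f(2)[OF that] by simp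
  have factor: "s k \<cdot> u = s i" if "i \<in> I" "k \<in> I" "u \<in> Hom C (Dom C (n i)) (Dom C (n k))" "n k \<cdot> u = n i" for i k u
  proof -
    have "m \<cdot> (s k \<cdot> u) = m \<cdot> s i"
      using Comp_assoc[OF m(2) s[OF that(2)] that(3)] ms that by simp
    then show ?thesis using monicD[OF m Comp_Hom[OF s[OF that(2)] that(3)] s[OF that(1)]] by blast
  qed
  \<comment> \<open>The sum of two representatives has support in \<open>U\<close> again, so it lies
    below a further representative, which bounds both.\<close>
  have dir: "\<exists>k \<in> I. (\<exists>u \<in> Hom C (Dom C (n i)) (Dom C (n k)). s k \<cdot> u = s i) \<and>
      (\<exists>u \<in> Hom C (Dom C (n j)) (Dom C (n k)). s k \<cdot> u = s j)" if ij: "i \<in> I" "j \<in> I" for i j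
  proof -
    obtain x X u1 u2 where x: "monic C x" "x \<in> Hom C X M" "ASupp C X \<subseteq> U"
      and u: "u1 \<in> Hom C (Dom C (n i)) X" "x \<cdot> u1 = n i" "u2 \<in> Hom C (Dom C (n j)) X" "x \<cdot> u2 = n j"
      using subobj_sum[OF n(1)[OF ij(1)] n(1)[OF ij(2)] n(3)[OF ij(1)] n(3)[OF ij(2)]] .
    have "x \<in> ?S" using x by (auto simp: subobj_def Hom_def)
    then obtain k where k: "k \<in> I" "sub_le C x (n k)" using rep by blast
    then obtain y where y: "y \<in> Hom C X (Dom C (n k))" "n k \<cdot> y = x"
      using x Hom_Dom by (metis sub_le_def)
    have "n k \<cdot> (y \<cdot> u1) = n i" "n k \<cdot> (y \<cdot> u2) = n j"
      using Comp_assoc[OF n(1)[OF k(1)] y(1) u(1)] Comp_assoc[OF n(1)[OF k(1)] y(1) u(3)] y u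
        by auto
    then show ?thesis
      using factor[OF ij(1) k(1) Comp_Hom[OF y(1) u(1)]] factor[OF ij(2) k(1) Comp_Hom[OF y(1) u(3)]]
        Comp_Hom[OF y(1) u(1)] Comp_Hom[OF y(1) u(3)] k(1) by blast
  qed
  have cover: "g = Zer C S W" if g: "g \<in> Hom C S W" "\<And>i. i \<in> I \<Longrightarrow> g \<cdot> s i = Zer C (Dom C (n i)) W" for W g
  proof -
    have W: "W \<in> Obj C" using Hom_Obj[OF g(1)] by blast
    have ge: "g \<cdot> e \<in> Hom C T W" using Comp_Hom[OF g(1) e(2)] .
    have "g \<cdot> e \<cdot> c i = Zer C (Dom C (n i)) W" if i: "i \<in> I" for i
      using Comp_assoc[OF g(1) e(2) cH[OF i]] g(2)[OF i] by (simp add: s_def)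
    moreover have "Zer C T W \<cdot> c i = Zer C (Dom C (n i)) W" if i: "i \<in> I" for i
      using Zer_Comp[OF cH[OF i] W] .
    moreover have "\<And>i. i \<in> I \<Longrightarrow> Zer C (Dom C (n i)) W \<in> Hom C (Dom C (n i)) W" using Zer_Hom[OF NO W] .
    ultimately have "g \<cdot> e = Zer C T W"
      using uniq[OF W, of "\<lambda>i. Zer C (Dom C (n i)) W"] ge Zer_Hom[OF TO W] by blast
    then show ?thesis using epic_zeroD[OF e g(1)] by blast
  qed
  have "ASupp C S \<subseteq> U"
  proof
    fix \<alpha> assume "\<alpha> \<in> ASupp C S"
    then obtain H where \<alpha>: "\<alpha> \<in> ASpec C"
      and H: "H \<in> \<alpha>" "subquotient C H S" by (auto simp: ASupp_def)
    have "nonzero_obj C H" using atom_monoform[OF \<alpha> H(1)] monoform_nonzero by blast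
    then obtain i K
      where "i \<in> I" "nonzero_obj C K" "embeds C K H" "subquotient C K (Dom C (n i))"
      using directed_cover_subquotient[OF I Ine s dir cover _ H(2)] by blast
    then show "\<alpha> \<in> U" using ASupp_subquotient[OF \<alpha> H(1)] n(3) by blast
  qed
  moreover have "sub_le C x m" if x: "subobj C M x" "ASupp C (Dom C x) \<subseteq> U" for x
  proof -
    obtain i where i: "i \<in> I" "sub_le C x (n i)" using rep x by blast
    then obtain y where y: "y \<in> Hom C (Dom C x) (Dom C (n i))" "n i \<cdot> y = x"
      by (auto simp: sub_le_def)
    have "m \<cdot> (s i \<cdot> y) = x"
      using Comp_assoc[OF m(2) s[OF i(1)] y(1)] ms[OF i(1)] y by simp
    then show ?thesis
      unfolding sub_le_def using Comp_Hom[OF s[OF i(1)] y(1)] Hom_Dom[OF m(2)] by blast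
  qed
  ultimately show ?thesis using that[of m] m by (auto simp: subobj_def Hom_Dom Hom_Cod)
qed

text \<open>A morphism sends the largest subobject of its source into that of its target, because
  the image is a quotient and quotients have no larger support. The functor laws come from
  cancelling the monic inclusions \<open>n\<close>.\<close>

lemma section_functor_exists:
  assumes U: "atom_open C U"
  shows "\<exists>\<Gamma>. is_section_functor C U \<Gamma>"
proof -
  have "\<forall>M. \<exists>n. M \<in> Obj C \<longrightarrow> subobj C M n \<and> ASupp C (Dom C n) \<subseteq> U \<and>
      (\<forall>m. subobj C M m \<and> ASupp C (Dom C m) \<subseteq> U \<longrightarrow> sub_le C m n)"
    using largest_subobj[of _ U] by metis
  then obtain n where n: "\<And>M. M \<in> Obj C \<Longrightarrow> subobj C M (n M)"
    "\<And>M. M \<in> Obj C \<Longrightarrow> ASupp C (Dom C (n M)) \<subseteq> U"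
    "\<And>M m. \<lbrakk>M \<in> Obj C; subobj C M m; ASupp C (Dom C m) \<subseteq> U\<rbrakk> \<Longrightarrow> sub_le C m (n M)" by metis
  have nH: "n M \<in> Hom C (Dom C (n M)) M" "monic C (n M)" if "M \<in> Obj C" for M
    using n(1)[OF that] monic_Hom[of "n M"] by (auto simp: subobj_def)
  define F where "F f = (SOME g. g \<in> Hom C (Dom C (n (Dom C f))) (Dom C (n (Cod C f))) \<and>
    n (Cod C f) \<cdot> g = f \<cdot> n (Dom C f))" for f
  have F: "F f \<in> Hom C (Dom C (n X)) (Dom C (n Y))" "n Y \<cdot> F f = f \<cdot> n X" if f: "f \<in> Hom C X Y" for f X Y
  proof -
    have X: "X \<in> Obj C" and Y: "Y \<in> Obj C" using Hom_Obj[OF f] by auto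
    have fn: "f \<cdot> n X \<in> Hom C (Dom C (n X)) Y" using Comp_Hom[OF f nH(1)[OF X]] .
    obtain I e m where e: "epic C e" "e \<in> Hom C (Dom C (n X)) I"
      and m: "monic C m" "m \<in> Hom C I Y"
      and fme: "f \<cdot> n X = m \<cdot> e" using image_exists[OF fn] .
    have "ASupp C I \<subseteq> U" using ASupp_epic[OF e] n(2)[OF X] by blast
    then have "sub_le C m (n Y)" using n(3)[OF Y, of m] m by (auto simp: subobj_def Hom_def)
    then obtain g where g: "g \<in> Hom C I (Dom C (n Y))" "n Y \<cdot> g = m"
      using Hom_Dom[OF m(2)] by (auto simp: sub_le_def)
    have "n Y \<cdot> (g \<cdot> e) = f \<cdot> n X"
      using Comp_assoc[OF nH(1)[OF Y] g(1) e(2)] g(2) fme by simp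
    then have "\<exists>g. g \<in> Hom C (Dom C (n X)) (Dom C (n Y)) \<and> n Y \<cdot> g = f \<cdot> n X"
      using Comp_Hom[OF g(1) e(2)] by blast
    from someI_ex[OF this]
    show "F f \<in> Hom C (Dom C (n X)) (Dom C (n Y))" "n Y \<cdot> F f = f \<cdot> n X"
      unfolding F_def Hom_Dom[OF f] Hom_Cod[OF f] by auto
  qed
  define \<Gamma>
    where "\<Gamma> = \<lparr>Fobj = (\<lambda>M. Dom C (n M)), Farr = F, Incl = n\<rparr>"
  have "is_functor C C \<Gamma>"
    unfolding is_functor_def
  proof (intro conjI ballI allI)
    show "cat C" by (rule cat_axioms)
    fix X assume X: "X \<in> Obj C"
    show D: "Fobj \<Gamma> X \<in> Obj C" using Hom_Obj[OF nH(1)[OF X]] by (simp add: \<Gamma>_def)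
    have "n X \<cdot> F (Idn C X) = n X \<cdot> Idn C (Dom C (n X))"
      using F(2)[OF Idn_Hom[OF X]] Idn_Comp[OF nH(1)[OF X]] Comp_Idn[OF nH(1)[OF X]] by simp
    then show "Farr \<Gamma> (Idn C X) = Idn C (Fobj \<Gamma> X)"
      using monicD[OF nH(2,1)[OF X] F(1)[OF Idn_Hom[OF X]] Idn_Hom] D by (simp add: \<Gamma>_def)
  next
    fix X Y f assume f: "f \<in> Hom C X Y"
    then show "Farr \<Gamma> f \<in> Hom C (Fobj \<Gamma> X) (Fobj \<Gamma> Y)"
      using F(1)[OF f] by (simp add: \<Gamma>_def)
  next
    fix X Y Z g f assume g: "g \<in> Hom C Y Z" and f: "f \<in> Hom C X Y"
    have X: "X \<in> Obj C" and Y: "Y \<in> Obj C" and Z: "Z \<in> Obj C"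
      using Hom_Obj[OF f] Hom_Obj[OF g] by auto
    note gf = Comp_Hom[OF g f]
    have "n Z \<cdot> F (g \<cdot> f) = g \<cdot> (f \<cdot> n X)"
      using F(2)[OF gf] Comp_assoc[OF g f nH(1)[OF X]] by simp
    also have "\<dots> = g \<cdot> n Y \<cdot> F f"
      using F(2)[OF f] Comp_assoc[OF g nH(1)[OF Y] F(1)[OF f]] by simp
    also have "\<dots> = n Z \<cdot> (F g \<cdot> F f)"
      using F(2)[OF g] Comp_assoc[OF nH(1)[OF Z] F(1)[OF g] F(1)[OF f]] by simp
    finally show "Farr \<Gamma> (g \<cdot> f) = Farr \<Gamma> g \<cdot> Farr \<Gamma> f"
      using monicD[OF nH(2,1)[OF Z] F(1)[OF gf] Comp_Hom[OF F(1)[OF g] F(1)[OF f]]]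
        by (simp add: \<Gamma>_def)
  qed (rule cat_axioms)
  moreover have "nat_trans C C \<Gamma> id_functor (Incl \<Gamma>)"
    unfolding nat_trans_def id_functor_def \<Gamma>_def using nH F(2) by simp
  ultimately have "is_preradical C \<Gamma>"
    unfolding is_preradical_def using nH by (simp add: \<Gamma>_def)
  then have "is_section_functor C U \<Gamma>"
    unfolding is_section_functor_def using U n by (simp add: \<Gamma>_def)
  then show ?thesis by blast
qed

end

section \<open>Monoform subobjects and torsion classes\<close>

text \<open>The chain condition speaks of sequences; a family without a maximal member would yield,
  by dependent choice, a sequence that never becomes stationary.\<close>

lemma noetherian_maximal:
  assumes G: "noetherian_obj C G" and ne: "m0 \<in> \<S>"
    and S: "\<And>m. m \<in> \<S> \<Longrightarrow> subobj C G m"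
  obtains m
    where "m \<in> \<S>" "\<And>m'. \<lbrakk>m' \<in> \<S>; sub_le C m m'\<rbrakk> \<Longrightarrow> sub_le C m' m"
proof (rule ccontr)
  note maximal = that
  assume "\<not> thesis"
  then have "\<exists>m'. m' \<in> \<S> \<and> sub_le C m m' \<and> \<not> sub_le C m' m" if "m \<in> \<S>" for m
    using maximal[OF that] by blast
  then obtain f where f: "\<And>n :: nat. f n \<in> \<S>"
    "\<And>n. sub_le C (f n) (f (Suc n)) \<and> \<not> sub_le C (f (Suc n)) (f n)"
    using dependent_nat_choice[of "\<lambda>_ m. m \<in> \<S>" "\<lambda>_ m m'. sub_le C m m' \<and> \<not> sub_le C m' m"] ne by metis
  have "\<exists>N. \<forall>n \<ge> N. sub_le C (f n) (f N)"
    using G f S unfolding noetherian_obj_def by blast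
  then show False using f(2) by (metis le_SucI order_refl)
qed

context locally_noetherian_cat
begin

text \<open>Take \<open>l\<close> maximal among the subobjects of a noetherian generator \<open>G\<close> such that \<open>G / l\<close> and
  \<open>M\<close> share a nonzero subobject; any such common subobject \<open>X\<close> is monoform, since a failure at
  \<open>K \<subseteq> X\<close> lets \<open>l\<close> be enlarged to the preimage of \<open>K\<close>.\<close>

lemma monoform_subobj_exists:
  assumes M: "nonzero_obj C M"
  obtains H where "monoform C H" "embeds C H M"
proof -
  have MO: "M \<in> Obj C" using M by (simp add: nonzero_obj_def)
  obtain \<G> where gen: "is_generator C \<G>" "\<forall>G \<in> \<G>. noetherian_obj C G"
    using ex_noetherian_generators by blast
  \<comment> \<open>The family \<open>\<G>\<close> separates the identity of \<open>M\<close> from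
    zero, which gives a nonzero morphism to \<open>M\<close> from some \<open>G\<close> in
    it.\<close>
  have "Idn C M \<noteq> Zer C M M" using M zero_obj_iff by (auto simp: nonzero_obj_def)
  then obtain G h where G: "G \<in> \<G>"
    and h: "h \<in> Hom C G M" "Idn C M \<cdot> h \<noteq> Zer C M M \<cdot> h"
    using gen(1) Idn_Hom[OF MO] Zer_Hom[OF MO MO] unfolding is_generator_def by blast
  have h0: "h \<noteq> Zer C G M" using h Idn_Comp[OF h(1)] Zer_Comp[OF h(1) MO] by simp
  define \<S> where "\<S> = {l. subobj C G l \<and>
    (\<exists>q X. is_cokernel C l q \<and> nonzero_obj C X \<and> embeds C X M \<and> embeds C X (Cod C q))}"
  obtain I e m where e: "epic C e" "e \<in> Hom C G I" and m: "monic C m" "m \<in> Hom C I M"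
    and hme: "h = m \<cdot> e"
    using image_exists[OF h(1)] .
  have GO: "G \<in> Obj C" using Hom_Obj[OF h(1)] by blast
  have "e \<noteq> Zer C G I" using h0 hme Comp_Zer[OF m(2) GO] by auto
  then have I: "nonzero_obj C I" using nonzero_objI[OF e(2)] by blast
  \<comment> \<open>This kernel shows that the family is nonempty: the quotient of \<open>G\<close>
    by it is \<open>I\<close>, a nonzero subobject of \<open>M\<close>.\<close>
  obtain K k where k: "is_kernel C e k" "k \<in> Hom C K G" "monic C k"
    using kernel_exists[OF e(2)] .
  have "is_cokernel C k e" using epic_is_cokernel[OF e k(1)] .
  moreover have "embeds C I M" using m by (auto simp: embeds_def)
  moreover have "embeds C I (Cod C e)"
    using embeds_refl I Hom_Cod[OF e(2)] by (simp add: nonzero_obj_def)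
  ultimately have "k \<in> \<S>" unfolding \<S>_def subobj_def using I k Hom_Cod[OF k(2)] by blast
  then obtain l where l: "l \<in> \<S>"
    and max: "\<And>l'. \<lbrakk>l' \<in> \<S>; sub_le C l l'\<rbrakk> \<Longrightarrow> sub_le C l' l"
    using noetherian_maximal[of C G k \<S>] gen(2) G unfolding \<S>_def by blast
  have lH: "monic C l" "l \<in> Hom C (Dom C l) G"
    using l monic_Hom[of l] by (auto simp: \<S>_def subobj_def)
  obtain q X where q: "is_cokernel C l q"
    and X: "nonzero_obj C X" "embeds C X M" "embeds C X (Cod C q)"
    using l unfolding \<S>_def by blast
  define Q where "Q = Cod C q"
  have qH: "q \<in> Hom C G Q" "epic C q" "q \<cdot> l = Zer C (Dom C l) Q"
    using cokernelD[OF q lH(2)] by (auto simp: Q_def)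
  obtain x where x: "monic C x" "x \<in> Hom C X Q" using X(3) by (auto simp: embeds_def Q_def)
  have "monoform C X"
    unfolding monoform_iff
  proof (intro conjI allI impI notI)
    show "nonzero_obj C X" by fact
    fix K n c Y
    assume a: "monic C n \<and> n \<in> Hom C K X \<and> nonzero_obj C K \<and> is_cokernel C n c \<and> nonzero_obj C Y \<and> embeds C Y X"
      and Yc: "embeds C Y (Cod C c)"
    then have n: "monic C n" "n \<in> Hom C K X" and K: "nonzero_obj C K" and c: "is_cokernel C n c"
      and Y: "nonzero_obj C Y" "embeds C Y X" by auto
    have cH: "c \<in> Hom C X (Cod C c)" "epic C c" using cokernelD[OF c n(2)] by auto
    have xn: "x \<cdot> n \<in> Hom C K Q" "monic C (x \<cdot> n)"
      using Comp_Hom[OF x(2) n(2)] monic_comp[OF x n] .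
    obtain P p
      where p: "is_cokernel C (x \<cdot> n) p" "p \<in> Hom C Q P" "epic C p" "p \<cdot> (x \<cdot> n) = Zer C K P"
      using cokernel_exists[OF xn(1)] .
    obtain j where "monic C j" "j \<in> Hom C (Cod C c) P"
      using pushout_monic[OF x cH(2,1) monic_is_kernel[OF n c] n(2) p(1,2)] by metis
    then have YP: "embeds C Y P" using Yc embeds_trans unfolding embeds_def by blast
    have pq: "p \<cdot> q \<in> Hom C G P" "epic C (p \<cdot> q)"
      using Comp_Hom[OF p(2) qH(1)] epic_comp[OF p(3,2) qH(2,1)] .
    \<comment> \<open>\<open>l'\<close> is the preimage in \<open>G\<close> of \<open>K\<close>,
      seen inside \<open>Q\<close>; the quotient of \<open>G\<close> by it is \<open>P\<close>, into
      which \<open>Y\<close> embeds.\<close>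
    obtain L l' where l': "is_kernel C (p \<cdot> q) l'" "l' \<in> Hom C L G" "monic C l'"
      using kernel_exists[OF pq(1)] .
    have ck: "is_cokernel C l' (p \<cdot> q)" using epic_is_cokernel[OF pq(2,1) l'(1)] .
    have "embeds C Y M" using Y(2) X(2) embeds_trans by blast
    then have "l' \<in> \<S>"
      unfolding \<S>_def subobj_def using l' Hom_Cod[OF l'(2)] ck Y(1) YP Hom_Cod[OF pq(1)] by auto
    moreover have "p \<cdot> q \<cdot> l = Zer C (Dom C l) P"
      using Comp_assoc[OF p(2) qH(1) lH(2)] qH(3) Comp_Zer[OF p(2)] Hom_Obj[OF lH(2)] by simp
    then have "sub_le C l l'"
      using kernel_factor[OF l'(1) pq(1) lH(2)] unfolding sub_le_def by metis
    \<comment> \<open>Maximality makes \<open>q\<close> vanish on \<open>l'\<close> and hence factor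
      through \<open>p \<cdot> q\<close>, so \<open>p\<close> is split monic. But \<open>p\<close>
      kills the nonzero \<open>K\<close>.\<close>
    ultimately have "sub_le C l' l" using max by blast
    then obtain u where u: "u \<in> Hom C L (Dom C l)" "l \<cdot> u = l'"
      using Hom_Dom[OF l'(2)] by (auto simp: sub_le_def)
    have "q \<cdot> l' = Zer C L Q"
      using Comp_assoc[OF qH(1) lH(2) u(1)] u(2) qH(3) Zer_Comp[OF u(1)] Hom_Obj[OF qH(1)] by simp
    then obtain t where t: "t \<in> Hom C P Q" "t \<cdot> (p \<cdot> q) = q"
      using cokernel_factor[OF ck l'(2) qH(1)] Hom_Cod[OF pq(1)] by metis
    have QO: "Q \<in> Obj C" using Hom_Obj[OF qH(1)] by blast
    have "t \<cdot> p \<cdot> q = Idn C Q \<cdot> q"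
      using Comp_assoc[OF t(1) p(2) qH(1)] t(2) Idn_Comp[OF qH(1)] by simp
    then have "t \<cdot> p = Idn C Q"
      using epicD[OF qH(2,1) Comp_Hom[OF t(1) p(2)] Idn_Hom[OF QO]] by blast
    then have "monic C p" using split_monic[OF p(2) t(1)] by blast
    then have "x \<cdot> n = Zer C K Q" using monic_zeroD[OF _ p(2) xn(1) p(4)] by blast
    then show False using monic_nonzero[OF xn(2,1) K] by simp
  qed
  then show ?thesis using that X(2) by blast
qed

end

section \<open>Preradicals and their torsion classes\<close>

context abelian_cat
begin

lemma preradicalD:
  assumes "is_preradical C \<gamma>"
  shows "M \<in> Obj C \<Longrightarrow> Incl \<gamma> M \<in> Hom C (Fobj \<gamma> M) M"
    and "M \<in> Obj C \<Longrightarrow> monic C (Incl \<gamma> M)"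
    and "f \<in> Hom C X Y \<Longrightarrow> Farr \<gamma> f \<in> Hom C (Fobj \<gamma> X) (Fobj \<gamma> Y)"
    and "f \<in> Hom C X Y \<Longrightarrow> Incl \<gamma> Y \<cdot> Farr \<gamma> f = f \<cdot> Incl \<gamma> X"
  using assms by (auto simp: is_preradical_def is_functor_def nat_trans_def id_functor_def)

text \<open>Naturality of the comparison maps is automatic: both ways around the square agree after
  the monic inclusion of \<open>\<delta>\<close>.\<close>

lemma preradical_leI:
  assumes \<gamma>: "is_preradical C \<gamma>" and \<delta>: "is_preradical C \<delta>"
    and le: "\<And>M. M \<in> Obj C \<Longrightarrow> sub_le C (Incl \<gamma> M) (Incl \<delta> M)"
  shows "preradical_le C \<gamma> \<delta>"
proof -
  note g = preradicalD[OF \<gamma>] and d = preradicalD[OF \<delta>]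
  have "\<exists>u. M \<in> Obj C \<longrightarrow> u \<in> Hom C (Fobj \<gamma> M) (Fobj \<delta> M) \<and> Incl \<delta> M \<cdot> u = Incl \<gamma> M" for M
    using le[of M] Hom_Dom[OF g(1), of M] Hom_Dom[OF d(1), of M] by (auto simp: sub_le_def)
  then obtain \<tau>
    where \<tau>: "\<And>M. M \<in> Obj C \<Longrightarrow> \<tau> M \<in> Hom C (Fobj \<gamma> M) (Fobj \<delta> M)"
    "\<And>M. M \<in> Obj C \<Longrightarrow> Incl \<delta> M \<cdot> \<tau> M = Incl \<gamma> M"
      by metis
  have "\<tau> Y \<cdot> Farr \<gamma> f = Farr \<delta> f \<cdot> \<tau> X" if f: "f \<in> Hom C X Y" for f X Y
  proof -
    have X: "X \<in> Obj C" and Y: "Y \<in> Obj C" using Hom_Obj[OF f] by auto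
    have "Incl \<delta> Y \<cdot> (\<tau> Y \<cdot> Farr \<gamma> f) = f \<cdot> Incl \<gamma> X"
      using Comp_assoc[OF d(1)[OF Y] \<tau>(1)[OF Y] g(3)[OF f]] \<tau>(2)[OF Y] g(4)[OF f] by simp
    also have "\<dots> = Incl \<delta> Y \<cdot> Farr \<delta> f \<cdot> \<tau> X"
      using Comp_assoc[OF f d(1)[OF X] \<tau>(1)[OF X]] \<tau>(2)[OF X] d(4)[OF f] by simp
    also have "\<dots> = Incl \<delta> Y \<cdot> (Farr \<delta> f \<cdot> \<tau> X)"
      using Comp_assoc[OF d(1)[OF Y] d(3)[OF f] \<tau>(1)[OF X]] .
    finally show ?thesis
      using monicD[OF d(2)[OF Y] d(1)[OF Y] Comp_Hom[OF \<tau>(1)[OF Y] g(3)[OF f]] Comp_Hom[OF d(3)[OF f] \<tau>(1)[OF X]]]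
      by blast
  qed
  then show ?thesis unfolding preradical_le_def nat_trans_def using \<tau> by blast
qed

text \<open>The comparison map is monic because its composite with the inclusion is, and the reverse
  containment gives it a section.\<close>

lemma preradical_eqI:
  assumes \<gamma>: "is_preradical C \<gamma>" and \<delta>: "is_preradical C \<delta>"
    and le: "preradical_le C \<gamma> \<delta>"
      and ge: "\<And>M. M \<in> Obj C \<Longrightarrow> sub_le C (Incl \<delta> M) (Incl \<gamma> M)"
  shows "preradical_eq C \<gamma> \<delta>"
proof -
  note g = preradicalD[OF \<gamma>] and d = preradicalD[OF \<delta>]
  obtain \<tau>
    where \<tau>: "nat_trans C C \<gamma> \<delta> \<tau>" "\<And>M. M \<in> Obj C \<Longrightarrow> Incl \<delta> M \<cdot> \<tau> M = Incl \<gamma> M"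
    using le by (auto simp: preradical_le_def)
  have "iso_arr C (\<tau> M)" if M: "M \<in> Obj C" for M
  proof -
    have \<tau>H: "\<tau> M \<in> Hom C (Fobj \<gamma> M) (Fobj \<delta> M)"
      using \<tau>(1) M by (simp add: nat_trans_def)
    obtain \<sigma>
      where \<sigma>: "\<sigma> \<in> Hom C (Fobj \<delta> M) (Fobj \<gamma> M)" "Incl \<gamma> M \<cdot> \<sigma> = Incl \<delta> M"
      using ge[OF M] Hom_Dom[OF g(1)[OF M]] Hom_Dom[OF d(1)[OF M]] by (auto simp: sub_le_def)
    have "monic C (Incl \<delta> M \<cdot> \<tau> M)" using g(2)[OF M] \<tau>(2)[OF M] by simp
    then have "monic C (\<tau> M)" using monic_right[OF _ d(1)[OF M] \<tau>H] by blast
    moreover have "Incl \<delta> M \<cdot> (\<tau> M \<cdot> \<sigma>) = Incl \<delta> M \<cdot> Idn C (Fobj \<delta> M)"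
      using Comp_assoc[OF d(1)[OF M] \<tau>H \<sigma>(1)] \<tau>(2)[OF M] \<sigma>(2)
        Comp_Idn[OF d(1)[OF M]] by simp
    then have "\<tau> M \<cdot> \<sigma> = Idn C (Fobj \<delta> M)"
      using monicD[OF d(2)[OF M] d(1)[OF M] Comp_Hom[OF \<tau>H \<sigma>(1)] Idn_Hom]
        Hom_Obj[OF \<sigma>(1)] by blast
    ultimately show ?thesis using monic_split_iso[OF _ \<tau>H \<sigma>(1)] by blast
  qed
  then show ?thesis unfolding preradical_eq_def using \<tau> by blast
qed

text \<open>By naturality \<open>Incl \<gamma> Q\<close> is the outer factor of the epic
  \<open>e \<cdot> Incl \<gamma> T\<close>, hence epic as well as monic.\<close>

lemma torsion_epic:
  assumes \<gamma>: "is_preradical C \<gamma>" and T: "T \<in> torsion_class C \<gamma>"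
    and e: "epic C e" "e \<in> Hom C T Q"
  shows "Q \<in> torsion_class C \<gamma>"
proof -
  note g = preradicalD[OF \<gamma>]
  have TO: "T \<in> Obj C" and Q: "Q \<in> Obj C" using Hom_Obj[OF e(2)] by auto
  have "epic C (Incl \<gamma> T)"
    using T iso_epic[OF _ g(1)[OF TO]] by (simp add: torsion_class_def)
  then have "epic C (Incl \<gamma> Q \<cdot> Farr \<gamma> e)"
    using epic_comp[OF e _ g(1)[OF TO]] g(4)[OF e(2)] by simp
  then have "epic C (Incl \<gamma> Q)" using epic_left[OF _ g(1)[OF Q] g(3)[OF e(2)]] by blast
  then show ?thesis using monic_epic_iso[OF g(2,1)[OF Q]] Q by (simp add: torsion_class_def)
qed

text \<open>Left exactness identifies \<open>Fobj \<gamma> N\<close> with the kernel of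
  \<open>Farr \<gamma> c\<close>. As \<open>T\<close> is torsion, \<open>m\<close> lifts into that
  kernel, and the lift is a section of \<open>Incl \<gamma> N\<close>.\<close>

lemma torsion_monic:
  assumes \<gamma>: "is_preradical C \<gamma>" "left_exact C C \<gamma>"
    and T: "T \<in> torsion_class C \<gamma>"
    and m: "monic C m" "m \<in> Hom C N T"
  shows "N \<in> torsion_class C \<gamma>"
proof -
  note g = preradicalD[OF \<gamma>(1)]
  have TO: "T \<in> Obj C" and N: "N \<in> Obj C" using Hom_Obj[OF m(2)] by auto
  obtain Q c where c: "is_cokernel C m c" "c \<in> Hom C T Q" "c \<cdot> m = Zer C N Q"
    using cokernel_exists[OF m(2)] by metis
  have Q: "Q \<in> Obj C" using Hom_Obj[OF c(2)] by blast
  have ker: "is_kernel C (Farr \<gamma> c) (Farr \<gamma> m)"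
    using \<gamma>(2) monic_is_kernel[OF m c(1)] by (simp add: left_exact_def)
  obtain s where s: "s \<in> Hom C T (Fobj \<gamma> T)" "Incl \<gamma> T \<cdot> s = Idn C T"
    using T iso_arrE[OF _ g(1)[OF TO]] by (auto simp: torsion_class_def)
  have sm: "s \<cdot> m \<in> Hom C N (Fobj \<gamma> T)" using Comp_Hom[OF s(1) m(2)] .
  have ism: "Incl \<gamma> T \<cdot> (s \<cdot> m) = m"
    using Comp_assoc[OF g(1)[OF TO] s(1) m(2)] s(2) Idn_Comp[OF m(2)] by simp
  have csm: "Farr \<gamma> c \<cdot> (s \<cdot> m) \<in> Hom C N (Fobj \<gamma> Q)"
    using Comp_Hom[OF g(3)[OF c(2)] sm] .
  \<comment> \<open>Vanishing is tested after the monic \<open>Incl \<gamma> Q\<close>, where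
    naturality turns it into the vanishing of \<open>c \<cdot> m\<close>.\<close>
  have "Incl \<gamma> Q \<cdot> (Farr \<gamma> c \<cdot> (s \<cdot> m)) = Zer C N Q"
    using Comp_assoc[OF g(1)[OF Q] g(3)[OF c(2)] sm] g(4)[OF c(2)]
      Comp_assoc[OF c(2) g(1)[OF TO] sm] ism c(3) by simp
  then have "Farr \<gamma> c \<cdot> (s \<cdot> m) = Zer C N (Fobj \<gamma> Q)"
    using monic_zeroD[OF g(2,1)[OF Q] csm] by blast
  then obtain v
    where v: "v \<in> Hom C N (Fobj \<gamma> N)" "Farr \<gamma> m \<cdot> v = s \<cdot> m"
    using kernel_factor[OF ker g(3)[OF c(2)] sm] Hom_Dom[OF g(3)[OF m(2)]] by metis
  have "m \<cdot> (Incl \<gamma> N \<cdot> v) = Incl \<gamma> T \<cdot> (Farr \<gamma> m \<cdot> v)"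
    using Comp_Comp_eq[OF g(4)[OF m(2)] g(3)[OF m(2)] g(1)[OF TO] g(1)[OF N] m(2) v(1)] by simp
  also have "\<dots> = m \<cdot> Idn C N" using v(2) ism Comp_Idn[OF m(2)] by simp
  finally have "Incl \<gamma> N \<cdot> v = Idn C N"
    using monicD[OF m Comp_Hom[OF g(1)[OF N] v(1)] Idn_Hom[OF N]] by blast
  then show ?thesis
    using monic_split_iso[OF g(2,1)[OF N] v(1)] N by (simp add: torsion_class_def)
qed

lemma torsion_subquotient:
  assumes \<gamma>: "is_preradical C \<gamma>" "left_exact C C \<gamma>"
    and T: "T \<in> torsion_class C \<gamma>" and H: "subquotient C H T"
  shows "H \<in> torsion_class C \<gamma>"
proof -
  obtain L n e where n: "monic C n" "n \<in> Hom C L T" and e: "epic C e" "e \<in> Hom C L H"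
    using subquotientE[OF H] .
  show ?thesis using torsion_epic[OF \<gamma>(1) torsion_monic[OF \<gamma> T n] e] .
qed

text \<open>The functor sends the quotient map \<open>c\<close> of \<open>M\<close> by its torsion
  part to zero, and the kernel of a zero morphism has a section. By left exactness that kernel is
  \<open>Farr \<gamma> (Incl \<gamma> M)\<close>.\<close>

lemma torsion_Fobj:
  assumes \<gamma>: "is_preradical C \<gamma>" "left_exact C C \<gamma>" and M: "M \<in> Obj C"
  shows "Fobj \<gamma> M \<in> torsion_class C \<gamma>"
proof -
  note g = preradicalD[OF \<gamma>(1)]
  note i = g(2,1)[OF M]
  let ?T = "Fobj \<gamma> M"
  have T: "?T \<in> Obj C" using Hom_Obj[OF i(2)] by blast
  obtain Q c
    where c: "is_cokernel C (Incl \<gamma> M) c" "c \<in> Hom C M Q" "c \<cdot> Incl \<gamma> M = Zer C ?T Q"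
    using cokernel_exists[OF i(2)] by metis
  have Q: "Q \<in> Obj C" using Hom_Obj[OF c(2)] by blast
  have ker: "is_kernel C (Farr \<gamma> c) (Farr \<gamma> (Incl \<gamma> M))"
    using \<gamma>(2) monic_is_kernel[OF i c(1)] by (simp add: left_exact_def)
  have "Incl \<gamma> Q \<cdot> Farr \<gamma> c = Zer C ?T Q" using g(4)[OF c(2)] c(3) by simp
  then have "Farr \<gamma> c = Zer C ?T (Fobj \<gamma> Q)"
    using monic_zeroD[OF g(2,1)[OF Q] g(3)[OF c(2)]] by blast
  then have "Farr \<gamma> c \<cdot> Idn C ?T = Zer C ?T (Fobj \<gamma> Q)"
    using Comp_Idn[OF g(3)[OF c(2)]] by simp
  then obtain s
    where s: "s \<in> Hom C ?T (Fobj \<gamma> ?T)" "Farr \<gamma> (Incl \<gamma> M) \<cdot> s = Idn C ?T"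
    using kernel_factor[OF ker g(3)[OF c(2)] Idn_Hom[OF T]] Hom_Dom[OF g(3)[OF i(2)]] by metis
  \<comment> \<open>Naturality at \<open>Incl \<gamma> M\<close> equates the functor applied to the
    inclusion with the inclusion of the torsion part of \<open>?T\<close>, after cancelling
    \<open>Incl \<gamma> M\<close>.\<close>
  have "Farr \<gamma> (Incl \<gamma> M) = Incl \<gamma> ?T"
    using monicD[OF i g(3)[OF i(2)] g(1)[OF T]] g(4)[OF i(2)] by blast
  then show ?thesis
    using monic_split_iso[OF g(2,1)[OF T] s(1)] s(2) T by (simp add: torsion_class_def)
qed

lemma ASupp_torsion:
  assumes \<gamma>: "is_preradical C \<gamma>" "left_exact C C \<gamma>"
    and T: "T \<in> torsion_class C \<gamma>"
  shows "ASupp C T \<subseteq> atoms_of C \<gamma>"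
  unfolding ASupp_def atoms_of_def using torsion_subquotient[OF \<gamma> T] atom_monoform by blast

text \<open>The torsion representative that puts an atom into the set also witnesses openness
  there.\<close>

lemma atom_open_atoms_of:
  assumes \<gamma>: "is_preradical C \<gamma>" "left_exact C C \<gamma>"
  shows "atom_open C (atoms_of C \<gamma>)"
  unfolding atom_open_def using ASupp_torsion[OF \<gamma>] by (auto simp: atoms_of_def)

end

section \<open>Comparison with the section functor\<close>

context locally_noetherian_cat
begin

lemma torsion_if_ASupp:
  assumes \<gamma>: "is_radical C \<gamma>" "left_exact C C \<gamma>"
    and N: "N \<in> Obj C" "ASupp C N \<subseteq> atoms_of C \<gamma>"
  shows "N \<in> torsion_class C \<gamma>"
proof -
  have pr: "is_preradical C \<gamma>" using \<gamma> by (simp add: is_radical_def)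
  note g = preradicalD[OF pr]
  note i = g(2,1)[OF N(1)]
  obtain Q q where q: "is_cokernel C (Incl \<gamma> N) q" "q \<in> Hom C N Q" "epic C q"
    using cokernel_exists[OF i(2)] .
  have zero: "\<not> nonzero_obj C (Fobj \<gamma> Q)"
    using \<gamma>(1) N(1) q(1) Hom_Cod[OF q(2)] by (auto simp: is_radical_def nonzero_obj_def)
  have "\<not> nonzero_obj C Q"
  proof
    assume "nonzero_obj C Q"
    then obtain H where H: "monoform C H" "embeds C H Q" using monoform_subobj_exists by blast
    obtain h where h: "monic C h" "h \<in> Hom C H Q" using H(2) by (auto simp: embeds_def)
    have "subquotient C H N" using subquotientI'[OF q(3,2) h] .
    then have "atom_equiv C `` {H} \<in> ASupp C N"
      using atom_class[OF H(1)] by (auto simp: ASupp_def)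
    then have "atom_equiv C `` {H} \<in> atoms_of C \<gamma>" using N(2) by blast
    then obtain H' where "(H, H') \<in> atom_equiv C" and H': "H' \<in> torsion_class C \<gamma>"
      by (auto simp: atoms_of_def)
    then obtain X where X: "nonzero_obj C X" "embeds C X H" "embeds C X H'"
      by (auto simp: atom_equiv_iff)
    \<comment> \<open>\<open>X\<close> is torsion as a subobject of \<open>H'\<close> and also
      embeds into \<open>Q\<close>, whose torsion part is zero; naturality along \<open>x\<close>
      then forces \<open>x\<close> to vanish.\<close>
    have XT: "X \<in> torsion_class C \<gamma>"
      using torsion_monic[OF pr \<gamma>(2) H'] X(3) by (auto simp: embeds_def)
    have XO: "X \<in> Obj C" using X(1) by (simp add: nonzero_obj_def)
    obtain x where x: "monic C x" "x \<in> Hom C X Q"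
      using embeds_trans[OF X(2) H(2)] by (auto simp: embeds_def)
    have "Farr \<gamma> x = Zer C (Fobj \<gamma> X) (Fobj \<gamma> Q)"
      using nonzero_objI[OF g(3)[OF x(2)]] zero by blast
    moreover have Q: "Q \<in> Obj C" and FX: "Fobj \<gamma> X \<in> Obj C"
      using Hom_Obj[OF x(2)] Hom_Obj[OF g(1)[OF XO]] by auto
    ultimately have "x \<cdot> Incl \<gamma> X = Zer C (Fobj \<gamma> X) Q"
      using g(4)[OF x(2)] Comp_Zer[OF g(1)[OF Q] FX] by simp
    moreover have "epic C (Incl \<gamma> X)"
      using XT iso_epic[OF _ g(1)[OF XO]] by (simp add: torsion_class_def)
    ultimately have "x = Zer C X Q" using epic_zeroD[OF _ g(1)[OF XO] x(2)] by blast
    then show False using monic_nonzero[OF x X(1)] by blast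
  qed
  \<comment> \<open>With \<open>Q\<close> zero, the identity of \<open>N\<close> factors through the
    kernel \<open>Incl \<gamma> N\<close> of \<open>q\<close>.\<close>
  then have "q = Zer C N Q" using nonzero_objI[OF q(2)] by blast
  then have "q \<cdot> Idn C N = Zer C N Q" using Comp_Idn[OF q(2)] by simp
  then obtain s where "s \<in> Hom C N (Fobj \<gamma> N)" "Incl \<gamma> N \<cdot> s = Idn C N"
    using kernel_factor[OF monic_is_kernel[OF i q(1)] q(2) Idn_Hom[OF N(1)]] Hom_Dom[OF i(2)]
      by metis
  then show ?thesis using monic_split_iso[OF i] N(1) by (simp add: torsion_class_def)
qed

lemma left_exact_preradical_section_functor:
  assumes \<gamma>: "is_preradical C \<gamma>" "left_exact C C \<gamma>"
  shows "preradical_le C \<gamma> (section_functor C (atoms_of C \<gamma>))"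
    and "is_radical C \<gamma> \<Longrightarrow> preradical_eq C \<gamma> (section_functor C (atoms_of C \<gamma>))"
proof -
  let ?U = "atoms_of C \<gamma>"
  define \<Gamma> where "\<Gamma> = section_functor C ?U"
  have sec: "is_section_functor C ?U \<Gamma>"
    unfolding \<Gamma>_def section_functor_def
      using someI_ex[OF section_functor_exists[OF atom_open_atoms_of[OF \<gamma>]]] .
  then have pr: "is_preradical C \<Gamma>" by (simp add: is_section_functor_def)
  note g = preradicalD[OF \<gamma>(1)] and G = preradicalD[OF pr]
  have "sub_le C (Incl \<gamma> M) (Incl \<Gamma> M)" if M: "M \<in> Obj C" for M
  proof -
    have "ASupp C (Dom C (Incl \<gamma> M)) \<subseteq> ?U"
      using ASupp_torsion[OF \<gamma> torsion_Fobj[OF \<gamma> M]] Hom_Dom[OF g(1)[OF M]] by simp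
    then show ?thesis
      using sec M g(2)[OF M] Hom_Cod[OF g(1)[OF M]]
        unfolding is_section_functor_def subobj_def by blast
  qed
  then have le: "preradical_le C \<gamma> \<Gamma>" using preradical_leI[OF \<gamma>(1) pr] by blast
  then show "preradical_le C \<gamma> (section_functor C ?U)" by (simp add: \<Gamma>_def)
  assume rad: "is_radical C \<gamma>"
  have "sub_le C (Incl \<Gamma> M) (Incl \<gamma> M)" if M: "M \<in> Obj C" for M
  proof -
    let ?N = "Fobj \<Gamma> M"
    have N: "?N \<in> Obj C" using Hom_Obj[OF G(1)[OF M]] by blast
    have "ASupp C ?N \<subseteq> ?U" using sec M by (simp add: is_section_functor_def)
    then have "?N \<in> torsion_class C \<gamma>"
      using torsion_if_ASupp[OF rad \<gamma>(2) N] by blast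
    then obtain s
      where s: "s \<in> Hom C ?N (Fobj \<gamma> ?N)" "Incl \<gamma> ?N \<cdot> s = Idn C ?N"
      using iso_arrE[OF _ g(1)[OF N]] by (auto simp: torsion_class_def)
    \<comment> \<open>The functor applied to \<open>Incl \<Gamma> M\<close> carries the torsion part
      of \<open>?N\<close> into that of \<open>M\<close>; since \<open>?N\<close> is torsion, all of
      \<open>Incl \<Gamma> M\<close> lifts.\<close>
    have "Incl \<gamma> M \<cdot> (Farr \<gamma> (Incl \<Gamma> M) \<cdot> s) = Incl \<Gamma> M"
      using
        Comp_Comp_eq[OF g(4)[OF G(1)[OF M]] g(3)[OF G(1)[OF M]] g(1)[OF M] g(1)[OF N] G(1)[OF M] s(1)]
        s(2) Comp_Idn[OF G(1)[OF M]] by simp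
    then show ?thesis
      unfolding sub_le_def using Comp_Hom[OF g(3)[OF G(1)[OF M]] s(1)]
        Hom_Dom[OF g(1)[OF M]] Hom_Dom[OF G(1)[OF M]] by auto
  qed
  then show "preradical_eq C \<gamma> (section_functor C ?U)"
    using preradical_eqI[OF \<gamma>(1) pr le] by (simp add: \<Gamma>_def)
qed

end

theorem theorem3p17:
  fixes \<kappa> :: "'k rel"
    and \<A> :: "('o, 'a, 'm) ab_cat_scheme"
    and \<gamma> :: "('o, 'a) preradical"
  assumes "locally_noetherian_cat \<kappa> \<A>"
    and "is_preradical \<A> \<gamma>"
    and "left_exact \<A> \<A> \<gamma>"
  shows "preradical_le \<A> \<gamma> (section_functor \<A> (atoms_of \<A> \<gamma>)) \<and>
         (is_radical \<A> \<gamma> \<longrightarrow> preradical_eq \<A> \<gamma> (section_functor \<A> (atoms_of \<A> \<gamma>)))"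
proof -
  interpret locally_noetherian_cat \<kappa> \<A> by fact
  show ?thesis using left_exact_preradical_section_functor[OF assms(2,3)] by blast
qed

end
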